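(* Let $d\ge 1$, $\alpha>0$, and let $\nu$ be a measure on the unit sphere $S^{d-1}\subset\mathbb{R}^d$ with $\nu(S^{d-1})=1$, supported by a finite set of distinct unit vectors $e^{(1)},\ldots,e^{(l)}$, with atoms $\nu_i=\nu(\{e^{(i)}\})>0$, $i=1,\ldots,l$, and such that $\mathrm{cone}\{e^{(1)},\ldots,e^{(l)}\}=\mathbb{R}^d$. Let $\pi_{\alpha,\nu}$ be the Poisson point process on $\mathbb{R}^d\setminus\{\mathbf 0\}$ with intensity measure $\mu=\theta\times\nu$, where $\theta$ has density $\alpha r^{-\alpha-1}$, $r>0$. Let $C_k(\pi_{\alpha,\nu})$ be the $k$-th convex hull in the peeling procedure applied to $\pi_{\alpha,\nu}$. Let $C_\infty$ be the convex hull of $A=\{\nu_1^{1/\alpha}e^{(1)},\ldots,\nu_l^{1/\alpha}e^{(l)}\}$. Then, as $k\to\infty$, $$d_H\left(k^{1/\alpha}C_k(\pi_{\alpha,\nu}),\,C_\infty\right)\to 0\quad\text{a.s.}$$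
   Context: Notation: $|x|$ is the Euclidean norm; $d_H$ is the Hausdorff distance between compact subsets of $\mathbb{R}^d$; $C(B)$ is the convex hull of $B\subset\mathbb{R}^d$; $\mathrm{ext}\,C$ is the set of extreme points of a convex set $C$ (the vertices if $C$ is a convex polyhedron); $\mathrm{cone}(B)$ is the (convex) cone generated by $B$, i.e. the set of all finite nonnegative linear combinations of elements of $B$. Intensity measure: $\mathbb{R}^d\setminus\{\mathbf 0\}$ is identified with $(0,\infty)\times S^{d-1}$ via $x\mapsto(|x|,x/|x|)$, and $\mu=\theta\times\nu$ means $\mu\{x:\ |x|\in B,\ x/|x|\in E\}=\theta(B)\nu(E)$ for Borel sets $B\subset(0,\infty)$, $E\subset S^{d-1}$. In the present case the process is a superposition of $l$ independent one-dimensional Poisson point processes on the rays $\{te^{(i)}:t>0\}$ with intensities $\nu_i\alpha r^{-\alpha-1}\,dr$. Peeling procedure: let $\varsigma_1$ be the (random) set of points of $\pi_{\alpha,\nu}$. Recursively, $C_k=C_k(\pi_{\alpha,\nu})=C(\varsigma_k)$ and $\varsigma_{k+1}=\varsigma_k\setminus\mathrm{ext}\,C_k$, $k=1,2,\ldots$. Almost surely all $C_k$ are polyhedra containing $\mathbf 0$. *)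

theory Defs
  imports "HOL-Probability.Probability"
begin

text \<open>
  The distance between nonempty compact sets. For unbounded or empty arguments the real-valued
  suprema and \<^const>\<open>infdist\<close> take default values, so it is meaningful only for nonempty
  compact arguments.
\<close>

definition hausdorff_distance :: "'a::metric_space set \<Rightarrow> 'a set \<Rightarrow> real" where
  "hausdorff_distance A B = max (SUP x\<in>A. infdist x B) (SUP y\<in>B. infdist y A)"

definition pareto_intensity :: "real \<Rightarrow> real measure" where
  "pareto_intensity \<alpha> =
     density (restrict_space lborel {0<..}) (\<lambda>r. ennreal (\<alpha> * r powr (- \<alpha> - 1)))"

text \<open>
  The product measure on \<open>(0,\<infinity>) \<times> S\<close> (with \<open>S\<close> the unit sphere), transported to the space
  without the origin by \<open>(r, u) \<mapsto> r u\<close>, the inverse of \<open>x \<mapsto> (|x|, x/|x|)\<close>.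
\<close>

definition polar_measure :: "real measure \<Rightarrow> 'a::euclidean_space measure \<Rightarrow> 'a measure" where
  "polar_measure \<theta> \<nu> =
     distr (\<theta> \<Otimes>\<^sub>M \<nu>) (restrict_space borel (- {0})) (\<lambda>(r, u). r *\<^sub>R u)"

lemma emeasure_polar_measure:
  fixes \<nu> :: "'a::euclidean_space measure"
  assumes \<theta>: "sets \<theta> = sets (restrict_space borel {0<..})"
    and \<nu>: "sets \<nu> = sets (restrict_space borel (sphere 0 1))" and fin: "finite_measure \<nu>"
    and B: "B \<in> sets borel" "B \<subseteq> {0<..}" and E: "E \<in> sets borel" "E \<subseteq> sphere 0 1"
  shows "emeasure (polar_measure \<theta> \<nu>) {x. x \<noteq> 0 \<and> norm x \<in> B \<and> x /\<^sub>R norm x \<in> E} =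
           emeasure \<theta> B * emeasure \<nu> E"
proof -
  interpret finite_measure \<nu> by (rule fin)
  let ?X = "{x::'a. x \<noteq> 0 \<and> norm x \<in> B \<and> x /\<^sub>R norm x \<in> E}"
  have sp: "space \<theta> = {0<..}" "space \<nu> = sphere 0 1"
    using sets_eq_imp_space_eq[OF \<theta>] sets_eq_imp_space_eq[OF \<nu>]
    by (auto simp: space_restrict_space)
  have "(\<lambda>p::real \<times> 'a. fst p *\<^sub>R snd p) \<in> borel_measurable (\<theta> \<Otimes>\<^sub>M \<nu>)"
  proof (rule borel_measurable_scaleR)
    have "(\<lambda>r. r) \<in> borel_measurable \<theta>"
      unfolding measurable_cong_sets[OF \<theta> refl] by (rule measurable_restrict_space1) simp
    then show "fst \<in> borel_measurable (\<theta> \<Otimes>\<^sub>M \<nu>)"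
      by (rule measurable_compose[OF measurable_fst])
    have "(\<lambda>u. u) \<in> borel_measurable \<nu>"
      unfolding measurable_cong_sets[OF \<nu> refl] by (rule measurable_restrict_space1) simp
    then show "snd \<in> borel_measurable (\<theta> \<Otimes>\<^sub>M \<nu>)"
      by (rule measurable_compose[OF measurable_snd])
  qed
  then have meas: "(\<lambda>(r, u). r *\<^sub>R u) \<in> measurable (\<theta> \<Otimes>\<^sub>M \<nu>) (restrict_space borel (- {0}))"
    by (intro measurable_restrict_space2) (auto simp: space_pair_measure sp split_beta)
  have "?X = - {0} \<inter> (norm -` B \<inter> space borel) \<inter> ((\<lambda>x. x /\<^sub>R norm x) -` E \<inter> space borel)"
    by auto
  also have "\<dots> \<in> sets borel"
    using B E by (intro sets.Int measurable_sets[of _ borel borel]) auto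
  finally have "?X \<in> sets (restrict_space borel (- {0}))"
    by (auto simp: sets_restrict_space)
  then have "emeasure (polar_measure \<theta> \<nu>) ?X =
      emeasure (\<theta> \<Otimes>\<^sub>M \<nu>) ((\<lambda>(r, u). r *\<^sub>R u) -` ?X \<inter> space (\<theta> \<Otimes>\<^sub>M \<nu>))"
    unfolding polar_measure_def by (rule emeasure_distr[OF meas])
  also have "(\<lambda>(r, u). r *\<^sub>R u) -` ?X \<inter> space (\<theta> \<Otimes>\<^sub>M \<nu>) = B \<times> E"
  proof -
    have "r *\<^sub>R u \<in> ?X \<longleftrightarrow> r \<in> B \<and> u \<in> E" if "r > 0" "norm u = 1" for r and u :: 'a
    proof -
      have "u \<noteq> 0" "norm (r *\<^sub>R u) = r" "(r *\<^sub>R u) /\<^sub>R r = u" using that by auto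
      then show ?thesis using \<open>r > 0\<close> by simp
    qed
    moreover have "r > 0" if "r \<in> B" for r using B(2) that by auto
    moreover have "norm u = 1" if "u \<in> E" for u using E(2) that by auto
    ultimately have iff: "r > 0 \<and> norm u = 1 \<and> r *\<^sub>R u \<in> ?X \<longleftrightarrow> r \<in> B \<and> u \<in> E" for r and u :: 'a
      by blast
    have "p \<in> (\<lambda>(r, u). r *\<^sub>R u) -` ?X \<inter> space (\<theta> \<Otimes>\<^sub>M \<nu>) \<longleftrightarrow> p \<in> B \<times> E" for p
      using iff[of "fst p" "snd p"]
      by (simp only: space_pair_measure sp vimage_eq split_beta Int_iff mem_Times_iff
          mem_sphere_0 greaterThan_iff) blast
    then show ?thesis by blast
  qed
  also have "emeasure (\<theta> \<Otimes>\<^sub>M \<nu>) (B \<times> E) = emeasure \<theta> B * emeasure \<nu> E"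
    using B E by (intro emeasure_pair_measure_Times) (auto simp: \<theta> \<nu> sets_restrict_space)
  finally show ?thesis .
qed

definition point_count :: "('w \<Rightarrow> 'a set) \<Rightarrow> 'a set \<Rightarrow> 'w \<Rightarrow> ennreal" where
  "point_count \<xi> B \<omega> = emeasure (count_space UNIV) (\<xi> \<omega> \<inter> B)"

text \<open>
  A Poisson process as a random set of points. Points of a set have multiplicity one, which is
  the appropriate model for diffuse intensities, whose Poisson processes are almost surely simple.
  The library's \<open>poisson_pmf\<close> requires a positive rate, so the probabilities are written out;
  mean \<open>0\<close> gives the point mass at \<open>0\<close>.
\<close>

definition poisson_point_process ::
    "'w measure \<Rightarrow> 'a measure \<Rightarrow> ('w \<Rightarrow> 'a set) \<Rightarrow> bool" where
  "poisson_point_process M \<mu> \<xi> \<longleftrightarrow>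
     prob_space M \<and>
     (\<forall>\<omega>\<in>space M. \<xi> \<omega> \<subseteq> space \<mu>) \<and>
     (\<forall>B\<in>sets \<mu>. point_count \<xi> B \<in> borel_measurable M) \<and>
     (\<forall>B\<in>sets \<mu>. emeasure \<mu> B < \<infinity> \<longrightarrow>
        (\<forall>n::nat. measure M {\<omega> \<in> space M. point_count \<xi> B \<omega> = of_nat n} =
           measure \<mu> B ^ n / fact n * exp (- measure \<mu> B))) \<and>
     (\<forall>B\<in>sets \<mu>. emeasure \<mu> B = \<infinity> \<longrightarrow> (AE \<omega> in M. point_count \<xi> B \<omega> = \<infinity>)) \<and>
     (\<forall>(n::nat) B. (\<forall>i<n. B i \<in> sets \<mu>) \<longrightarrow> disjoint_family_on B {..<n} \<longrightarrow>
        prob_space.indep_vars M (\<lambda>_. borel) (\<lambda>i. point_count \<xi> (B i)) {..<n})"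

definition remove_extreme_points :: "'a::real_vector set \<Rightarrow> 'a set" where
  "remove_extreme_points S = S - {x. x extreme_point_of (convex hull S)}"

text \<open>
  The \<open>k\<close>-th hull, for \<open>k \<ge> 1\<close>: the hull of the points left after \<open>k - 1\<close> removals.
\<close>

definition peeling_hull :: "'a::real_vector set \<Rightarrow> nat \<Rightarrow> 'a set" where
  "peeling_hull S k = convex hull ((remove_extreme_points ^^ (k - 1)) S)"

end

theory Submission
  imports Defs "HOL-Real_Asymp.Real_Asymp"
begin

text \<open>
  Only the strong law along each ray is random: almost surely, for each \<open>i\<close>, the number of points of
  the \<open>i\<close>-th ray beyond distance \<open>s\<close> is asymptotic to \<open>\<nu>\<^sub>i s powr (- \<alpha>)\<close> as \<open>s \<rightarrow> 0\<close>. By monotonicity it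
  suffices to see this along \<open>s = n powr (- 2 / \<alpha>)\<close>, where it follows from Chebyshev's inequality and
  Borel--Cantelli.

  The rest is deterministic. A peeling step removes at most one point from every ray, so \<open>C\<^sub>k\<close>
  still contains the \<open>k\<close>-th outermost point of each ray, which gives the lower bound. For the upper
  bound, choose \<open>b\<^sub>i \<ge> \<nu>\<^sub>i powr (1 / \<alpha>)\<close> such that the points \<open>b\<^sub>i e\<^sub>i\<close> lie in \<open>(1 + \<epsilon>) C\<^sub>\<infinity>\<close> but
  are all exposed in their convex hull. By stability of exposedness, a ray whose outermost radius
  relative to \<open>b\<^sub>i\<close> is nearly the largest one loses a point at this step. Hence the rays that are
  furthest out all retreat at full speed, one point per step, and after \<open>k\<close> steps all radii are
  below about \<open>k powr (- 1 / \<alpha>) b\<^sub>i\<close>.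
\<close>

section \<open>Exposed points on rays\<close>

text \<open>Adjoining the single point \<open>x\<close> to the open half-space where
  \<open>u\<close> stays below its value at \<open>x\<close> gives a convex set. The strict
  inequality therefore passes from \<open>S\<close> to its hull, although \<open>S\<close> may be
  infinite, and a unique maximiser on the hull cannot lie inside a segment.\<close>

lemma extreme_point_of_convex_hull_unique_max:
  fixes u :: "'a::real_inner"
  assumes "x \<in> S" and less: "\<And>y. y \<in> S \<Longrightarrow> y \<noteq> x \<Longrightarrow> u \<bullet> y < u \<bullet> x"
  shows "x extreme_point_of (convex hull S)"
proof -
  define T where "T = insert x {y. u \<bullet> y < u \<bullet> x}"
  have "convex T"
  proof (rule convexI)
    fix y z and s t :: real
    assume yz: "y \<in> T" "z \<in> T" and st: "0 \<le> s" "0 \<le> t" "s + t = 1"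
    have le: "u \<bullet> y \<le> u \<bullet> x" "u \<bullet> z \<le> u \<bullet> x"
      using yz by (auto simp: T_def)
    have "u \<bullet> (s *\<^sub>R y + t *\<^sub>R z) < u \<bullet> x" if "s *\<^sub>R y + t *\<^sub>R z \<noteq> x"
    proof (cases "s = 0 \<or> t = 0")
      case True
      then show ?thesis using that yz st by (auto simp: T_def)
    next
      case False
      then have pos: "s > 0" "t > 0" using st by auto
      have "u \<bullet> y < u \<bullet> x \<or> u \<bullet> z < u \<bullet> x"
        using that yz st by (auto simp: T_def simp flip: scaleR_add_left)
      then have "s * (u \<bullet> y) + t * (u \<bullet> z) < s * (u \<bullet> x) + t * (u \<bullet> x)"
      proof
        assume "u \<bullet> y < u \<bullet> x"
        then show ?thesis using le pos by (intro add_less_le_mono) auto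
      next
        assume "u \<bullet> z < u \<bullet> x"
        then show ?thesis using le pos by (intro add_le_less_mono) auto
      qed
      also have "\<dots> = u \<bullet> x" using st by (simp flip: distrib_right)
      finally show ?thesis by (simp add: inner_add_right)
    qed
    then show "s *\<^sub>R y + t *\<^sub>R z \<in> T" by (auto simp: T_def)
  qed
  then have sub: "convex hull S \<subseteq> T"
    using less by (intro hull_minimal) (auto simp: T_def)
  have "x \<notin> open_segment y z" if yz: "y \<in> convex hull S" "z \<in> convex hull S" for y z
  proof
    assume "x \<in> open_segment y z"
    then obtain t where t: "0 < t" "t < 1" "x = (1 - t) *\<^sub>R y + t *\<^sub>R z" and "y \<noteq> z"
      by (auto simp: in_segment)
    have le: "u \<bullet> y \<le> u \<bullet> x" "u \<bullet> z \<le> u \<bullet> x"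
      using sub yz by (auto simp: T_def)
    have "x \<noteq> y \<and> x \<noteq> z"
      using \<open>x \<in> open_segment y z\<close> by (auto simp: open_segment_def)
    then have "u \<bullet> y < u \<bullet> x" using sub yz by (auto simp: T_def)
    then have "(1 - t) * (u \<bullet> y) + t * (u \<bullet> z) < (1 - t) * (u \<bullet> x) + t * (u \<bullet> x)"
      using t le by (intro add_less_le_mono) auto
    also have "\<dots> = u \<bullet> x" by (simp add: algebra_simps)
    also have "u \<bullet> x = (1 - t) * (u \<bullet> y) + t * (u \<bullet> z)"
      by (subst t(3)) (simp add: inner_add_right)
    finally show False by simp
  qed
  then show ?thesis
    using assms(1) by (auto simp: extreme_point_of_def hull_inc)
qed

text \<open>A functional separating the origin from the hull would be nonnegative on every
  \<open>e i\<close>, so the cone they generate would lie in a half-space.\<close>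

lemma zero_in_convex_hull_if_positively_spanning:
  fixes a :: "'i \<Rightarrow> real" and e :: "'i \<Rightarrow> 'a::euclidean_space"
  assumes fin: "finite I" and a: "\<And>i. i \<in> I \<Longrightarrow> a i > 0"
    and cone: "convex_cone hull (e ` I) = UNIV"
  shows "0 \<in> convex hull ((\<lambda>i. a i *\<^sub>R e i) ` I)" (is "0 \<in> ?C")
proof (rule ccontr)
  assume "0 \<notin> ?C"
  moreover have "closed ?C"
    using fin by (intro compact_imp_closed finite_imp_compact_convex_hull) auto
  ultimately obtain v c where v: "v \<noteq> 0" "0 < c" "\<forall>x\<in>?C. v \<bullet> x > c"
    using separating_hyperplane_closed_0[of ?C] by auto
  have "v \<bullet> e i \<ge> 0" if i: "i \<in> I" for i
  proof -
    have "a i *\<^sub>R e i \<in> ?C" using i by (intro hull_inc) auto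
    then have "0 < a i * (v \<bullet> e i)" using v by force
    then show ?thesis using a[OF i] by (simp add: zero_less_mult_iff)
  qed
  moreover have "convex_cone {x. v \<bullet> x \<ge> 0}"
    by (auto simp: convex_cone_iff inner_add_right intro: exI[of _ 0])
  ultimately have "convex_cone hull (e ` I) \<subseteq> {x. v \<bullet> x \<ge> 0}"
    by (intro hull_minimal) auto
  then have "- v \<in> {x. v \<bullet> x \<ge> 0}" unfolding cone by blast
  then have "v \<bullet> v \<le> 0" by simp
  moreover have "v \<bullet> v > 0" using v(1) by (rule inner_gt_zero_iff[THEN iffD2])
  ultimately show False by linarith
qed

lemma scaleR_in_convex_antimono:
  fixes x :: "'a::real_vector"
  assumes "convex C" "0 \<in> C" "t *\<^sub>R x \<in> C" "0 \<le> s" "s \<le> t"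
  shows "s *\<^sub>R x \<in> C"
proof (cases "t = 0")
  case False
  then have "(1 - s / t) *\<^sub>R 0 + (s / t) *\<^sub>R (t *\<^sub>R x) \<in> C"
    using assms by (intro convexD) (auto simp: divide_simps)
  then show ?thesis using False by simp
qed (use assms in auto)

text \<open>A point \<open>a i *\<^sub>R e i\<close> may lie inside \<open>C\<close> or on one of
  its faces, and then nothing forces peeling to act on its ray. The points are pushed outward to a
  level set of a perturbed gauge of \<open>C\<close>, on which each of them is exposed; finitely
  many pairs allow one common gap \<open>q\<close>.\<close>

lemma exposing_functionals_exist:
  fixes a :: "'i \<Rightarrow> real" and e :: "'i \<Rightarrow> 'a::euclidean_space"
  fixes I :: "'i set"
  defines "C \<equiv> convex hull ((\<lambda>i. a i *\<^sub>R e i) ` I)"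
  assumes fin: "finite I" "I \<noteq> {}" and norm: "\<And>i. i \<in> I \<Longrightarrow> norm (e i) = 1"
    and inj: "inj_on e I" and a: "\<And>i. i \<in> I \<Longrightarrow> a i > 0" and 0: "0 \<in> C" and \<epsilon>: "\<epsilon> > 0"
  obtains b u q where "0 < q" "q < (1::real)"
    and "\<And>i. i \<in> I \<Longrightarrow> a i \<le> b i" "\<And>i. i \<in> I \<Longrightarrow> (b i / (1 + \<epsilon>)) *\<^sub>R e i \<in> C"
    and "\<And>i. i \<in> I \<Longrightarrow> u i \<bullet> (b i *\<^sub>R e i) = 1"
    and "\<And>i j. i \<in> I \<Longrightarrow> j \<in> I \<Longrightarrow> j \<noteq> i \<Longrightarrow> u i \<bullet> (b j *\<^sub>R e j) \<le> q"
proof -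
  \<comment> \<open>The factor \<open>1 + \<epsilon>\<close> is split in two: one
    \<open>1 + \<delta>\<close> pays for approximating the gauge of \<open>C\<close>, the other for
    the norm term added to it.\<close>
  define \<delta> where "\<delta> = min 1 (\<epsilon> / 3)"
  have \<delta>: "\<delta> > 0" "(1 + \<delta>) * (1 + \<delta>) \<le> 1 + \<epsilon>"
  proof -
    show "\<delta> > 0" using \<epsilon> by (simp add: \<delta>_def)
    have "\<delta> * \<delta> \<le> \<delta> * 1" using \<epsilon> by (intro mult_left_mono) (auto simp: \<delta>_def)
    then have "(1 + \<delta>) * (1 + \<delta>) \<le> 1 + 3 * \<delta>" by (simp add: algebra_simps)
    also have "\<dots> \<le> 1 + \<epsilon>" by (simp add: \<delta>_def)
    finally show "(1 + \<delta>) * (1 + \<delta>) \<le> 1 + \<epsilon>" .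
  qed
  have C: "convex C" "compact C" "closed C"
    using fin by (auto simp: C_def intro!: compact_imp_closed finite_imp_compact_convex_hull)
  have aC: "a i *\<^sub>R e i \<in> C" if "i \<in> I" for i
    using that by (auto simp: C_def intro!: hull_inc)
  have "\<exists>v t. t > 0 \<and> t *\<^sub>R e i \<in> C \<and> (\<forall>x\<in>C. v \<bullet> x < 1) \<and> v \<bullet> ((1 + \<delta>) *\<^sub>R t *\<^sub>R e i) > 1"
    if i: "i \<in> I" for i
  proof -
    \<comment> \<open>The ray leaves \<open>C\<close> at \<open>Sup T\<close>. A point slightly
      before it, multiplied by \<open>1 + \<delta>\<close>, falls outside \<open>C\<close>, and a
      hyperplane separating the enlarged point from \<open>C\<close> supplies
      \<open>v\<close>.\<close>
    define T where "T = {t. t *\<^sub>R e i \<in> C}"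
    obtain m where m: "\<And>x. x \<in> C \<Longrightarrow> norm x \<le> m"
      using compact_imp_bounded[OF C(2)] by (auto simp: bounded_iff)
    have "t \<le> m" if "t \<in> T" for t
      using m[of "t *\<^sub>R e i"] that norm[OF i] by (auto simp: T_def)
    then have bdd: "bdd_above T" by (auto simp: bdd_above_def)
    have aT: "a i \<in> T" using aC[OF i] by (simp add: T_def)
    then have "Sup T > 0" using a[OF i] cSup_upper[OF aT bdd] by linarith
    then have "Sup T / (1 + \<delta>) < Sup T" using \<delta> by (simp add: divide_simps)
    then obtain t where t: "t \<in> T" "Sup T / (1 + \<delta>) < t"
      using less_cSup_iff[of T] aT bdd by blast
    have "0 < Sup T / (1 + \<delta>)" using \<open>Sup T > 0\<close> \<delta> by simp
    then have "t > 0" using t(2) by linarith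
    have "(1 + \<delta>) * t > Sup T" using t(2) \<delta> by (simp add: divide_simps mult.commute)
    then have "(1 + \<delta>) * t \<notin> T" using cSup_upper[OF _ bdd] by fastforce
    then have out: "(1 + \<delta>) *\<^sub>R t *\<^sub>R e i \<notin> C" by (simp add: T_def)
    obtain w c where w: "w \<bullet> ((1 + \<delta>) *\<^sub>R t *\<^sub>R e i) < c" "\<forall>x\<in>C. w \<bullet> x > c"
      using separating_hyperplane_closed_point[OF C(1,3) out] by blast
    have "c < 0" using w(2) 0 by force
    \<comment> \<open>Division by the negative number \<open>c\<close> reverses both inequalities
      and moves the separating level to 1.\<close>
    define v where "v = (1 / c) *\<^sub>R w"
    have "v \<bullet> x < 1" if "x \<in> C" for x
      using w(2) that \<open>c < 0\<close> by (auto simp: v_def divide_simps)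
    moreover have "v \<bullet> ((1 + \<delta>) *\<^sub>R t *\<^sub>R e i) > 1"
      using w(1) \<open>c < 0\<close> by (simp add: v_def divide_simps)
    ultimately show ?thesis using \<open>t > 0\<close> t(1) by (auto simp: T_def)
  qed
  then obtain v t where t: "\<And>i. i \<in> I \<Longrightarrow> t i > 0" "\<And>i. i \<in> I \<Longrightarrow> t i *\<^sub>R e i \<in> C"
    and v: "\<And>i x. i \<in> I \<Longrightarrow> x \<in> C \<Longrightarrow> v i \<bullet> x < 1"
      "\<And>i. i \<in> I \<Longrightarrow> v i \<bullet> ((1 + \<delta>) *\<^sub>R t i *\<^sub>R e i) > 1"
    by metis
  define A where "A = Max (a ` I)"
  have A: "a i \<le> A" if "i \<in> I" for i using that fin by (auto simp: A_def)
  obtain i0 where "i0 \<in> I" using fin(2) by blast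
  then have "A > 0" using A[of i0] a[of i0] by linarith
  \<comment> \<open>With this choice the norm term contributes at most \<open>\<delta>\<close> to
    \<open>a i * p i\<close>, which yields \<open>a i \<le> b i\<close>.\<close>
  define \<eta> where "\<eta> = \<delta> / A"
  have "\<eta> > 0" using \<open>A > 0\<close> \<delta> by (simp add: \<eta>_def)
  \<comment> \<open>\<open>g\<close> approximates the gauge of \<open>C\<close>; adding \<open>\<eta>\<close> times the norm makes it strictly convex
    transversally to rays, so that every ray meets the unit sphere of \<open>p\<close> in an exposed point.\<close>
  define g where "g x = Max ((\<lambda>i. v i \<bullet> x) ` I)" for x
  define p where "p i = g (e i) + \<eta>" for i
  have g_ge: "v i \<bullet> x \<le> g x" if "i \<in> I" for i x
    using that fin by (auto simp: g_def)
  have "\<exists>j. j \<in> I \<and> v j \<bullet> x = g x" for x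
  proof -
    have "g x \<in> (\<lambda>i. v i \<bullet> x) ` I"
      unfolding g_def using fin by (intro Max_in) auto
    then obtain j where "g x = v j \<bullet> x" "j \<in> I" by (rule imageE)
    then show ?thesis by (intro exI[of _ j]) simp
  qed
  then have "\<forall>x. \<exists>j. j \<in> I \<and> v j \<bullet> x = g x" by blast
  from choice[OF this] obtain J where J: "\<And>x. J x \<in> I" "\<And>x. v (J x) \<bullet> x = g x" by blast
  have g_pos: "(1 + \<delta>) * t i * g (e i) > 1" if "i \<in> I" for i
  proof -
    have "1 < (1 + \<delta>) * t i * (v i \<bullet> e i)" using v(2)[OF that] by simp
    also have "\<dots> \<le> (1 + \<delta>) * t i * g (e i)"
      using t(1)[OF that] \<delta> by (intro mult_left_mono g_ge that) auto
    finally show ?thesis .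
  qed
  have p_pos: "p i > 0" "g (e i) > 0" if "i \<in> I" for i
  proof -
    have "0 < (1 + \<delta>) * t i * g (e i)" using g_pos[OF that] by linarith
    moreover have "0 < (1 + \<delta>) * t i" using t(1)[OF that] \<delta> by simp
    ultimately show "g (e i) > 0" using zero_less_mult_pos by blast
    then show "p i > 0" using \<open>\<eta> > 0\<close> by (simp add: p_def)
  qed
  define b where "b i = (1 + \<delta>) / p i" for i
  \<comment> \<open>Up to the factor \<open>1 / (1 + \<delta>)\<close> this is a subgradient at
    \<open>e i\<close> of \<open>g\<close> plus \<open>\<eta>\<close> times the norm: a functional
    attaining the maximum in \<open>g\<close>, and the gradient of the norm at a unit
    vector.\<close>
  define u where "u i = (1 / (1 + \<delta>)) *\<^sub>R (v (J (e i)) + \<eta> *\<^sub>R e i)" for i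
  define w where "w i j = u i \<bullet> (b j *\<^sub>R e j)" for i j
  have ee: "e i \<bullet> e i = 1" if "i \<in> I" for i
    using norm[OF that] by (simp add: norm_eq_1)
  have b_ge: "a i \<le> b i" if i: "i \<in> I" for i
  proof -
    have "a i * g (e i) = v (J (e i)) \<bullet> (a i *\<^sub>R e i)" by (simp add: J)
    also have "\<dots> \<le> 1" using v(1)[OF J(1) aC[OF i]] by (simp add: less_imp_le)
    finally have "a i * g (e i) \<le> 1" .
    moreover have "a i * \<eta> \<le> A * \<eta>" using A[OF i] \<open>\<eta> > 0\<close> by simp
    moreover have "A * \<eta> = \<delta>" using \<open>A > 0\<close> by (simp add: \<eta>_def)
    ultimately have "a i * p i \<le> 1 + \<delta>" by (simp add: p_def algebra_simps)
    then show ?thesis using p_pos[OF i] by (simp add: b_def pos_le_divide_eq)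
  qed
  have bC: "(b i / (1 + \<epsilon>)) *\<^sub>R e i \<in> C" if i: "i \<in> I" for i
  proof (rule scaleR_in_convex_antimono[OF C(1) 0 t(2)[OF i]])
    show "0 \<le> b i / (1 + \<epsilon>)" using b_ge[OF i] a[OF i] \<epsilon> by auto
    have "1 \<le> (1 + \<delta>) * t i * p i"
    proof -
      have "(1 + \<delta>) * t i * g (e i) \<le> (1 + \<delta>) * t i * p i"
        using t(1)[OF i] \<delta> \<open>\<eta> > 0\<close> by (intro mult_left_mono) (auto simp: p_def)
      then show ?thesis using g_pos[OF i] by linarith
    qed
    then have "1 / p i \<le> (1 + \<delta>) * t i" using p_pos[OF i] by (simp add: pos_divide_le_eq)
    then have "(1 + \<delta>) * (1 / p i) \<le> (1 + \<delta>) * ((1 + \<delta>) * t i)"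
      using \<delta> by (intro mult_left_mono) auto
    also have "\<dots> = ((1 + \<delta>) * (1 + \<delta>)) * t i" by simp
    also have "\<dots> \<le> (1 + \<epsilon>) * t i" using \<delta> t(1)[OF i] by (intro mult_right_mono) auto
    finally have "b i \<le> t i * (1 + \<epsilon>)" by (simp add: b_def mult.commute)
    then show "b i / (1 + \<epsilon>) \<le> t i" using \<epsilon> by (simp add: pos_divide_le_eq)
  qed
  have w: "w i j = (v (J (e i)) \<bullet> e j + \<eta> * (e i \<bullet> e j)) / p j" for i j
    using \<delta> by (simp add: w_def u_def b_def inner_add_left divide_simps)
  have ww: "w i i = 1" if "i \<in> I" for i
    using p_pos[OF that] ee[OF that] by (simp add: w J p_def)
  \<comment> \<open>The part coming from \<open>g\<close> gives only a weak inequality. Strictness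
    comes from the norm term, since distinct unit vectors have inner product below 1.\<close>
  have w_less: "w i j < 1" if ij: "i \<in> I" "j \<in> I" "j \<noteq> i" for i j
  proof -
    have "e i \<bullet> e j \<noteq> 1"
    proof
      assume "e i \<bullet> e j = 1"
      then have "norm (e i - e j) ^ 2 = 0"
        using ee ij by (simp add: power2_norm_eq_inner inner_diff_left inner_diff_right inner_commute)
      then show False using inj ij by (auto simp: inj_on_def)
    qed
    moreover have "e i \<bullet> e j \<le> 1"
      using norm_cauchy_schwarz[of "e i" "e j"] norm ij by simp
    ultimately have "\<eta> * (e i \<bullet> e j) < \<eta> * 1" using \<open>\<eta> > 0\<close> by (intro mult_strict_left_mono) auto
    then have "v (J (e i)) \<bullet> e j + \<eta> * (e i \<bullet> e j) < p j"
      using g_ge[OF J(1)] by (simp add: p_def add_le_less_mono)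
    then show ?thesis using p_pos[OF ij(2)] by (simp add: w)
  qed
  \<comment> \<open>The extra element \<open>1/2\<close> keeps the set nonempty for a single ray and
    makes the maximum positive even if all \<open>w i j\<close> are negative.\<close>
  define Q where "Q = insert (1/2) ((\<lambda>(i, j). w i j) ` {(i, j). i \<in> I \<and> j \<in> I \<and> j \<noteq> i})"
  have "finite {(i, j). i \<in> I \<and> j \<in> I \<and> j \<noteq> i}"
    by (rule finite_subset[of _ "I \<times> I"]) (use fin in auto)
  then have Q: "finite Q" "Q \<noteq> {}" by (auto simp: Q_def)
  have "Max Q \<ge> 1/2" using Q by (intro Max_ge) (auto simp: Q_def)
  then have "Max Q > 0" by linarith
  moreover have "Max Q < 1" using Q w_less by (auto simp: Q_def)
  moreover have "w i j \<le> Max Q" if "i \<in> I" "j \<in> I" "j \<noteq> i" for i j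
    using Q that by (intro Max_ge) (auto simp: Q_def)
  ultimately show ?thesis
    using b_ge bC ww by (intro that[of "Max Q" b u]) (simp_all only: w_def)
qed

section \<open>Peeling a set of points on finitely many rays\<close>

text \<open>These are properties of almost every realisation: all points lie on the rays, and on
  every ray infinitely many points accumulate only at the origin.\<close>

locale ray_configuration =
  fixes I :: "'i set" and e :: "'i \<Rightarrow> 'a::euclidean_space" and S :: "'a set"
  assumes finite_I: "finite I"
    and norm_e: "i \<in> I \<Longrightarrow> norm (e i) = 1"
    and inj_e: "inj_on e I"
    and on_rays: "x \<in> S \<Longrightarrow> \<exists>i\<in>I. \<exists>r>0. x = r *\<^sub>R e i"
    and finite_above: "i \<in> I \<Longrightarrow> s > 0 \<Longrightarrow> finite {r. s < r \<and> r *\<^sub>R e i \<in> S}"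
    and infinite_ray: "i \<in> I \<Longrightarrow> infinite {r. 0 < r \<and> r *\<^sub>R e i \<in> S}"
begin

definition radii :: "'a set \<Rightarrow> 'i \<Rightarrow> real set" where
  "radii T i = {r. 0 < r \<and> r *\<^sub>R e i \<in> T}"

text \<open>The index counts removals, so the \<open>k\<close>-th hull is the hull of
  \<open>peel (k - 1)\<close>.\<close>

definition peel :: "nat \<Rightarrow> 'a set" where
  "peel n = (remove_extreme_points ^^ n) S"

definition count_above :: "'i \<Rightarrow> real \<Rightarrow> nat" where
  "count_above i s = card {r. s < r \<and> r *\<^sub>R e i \<in> S}"

lemma radii_mono: "T \<subseteq> U \<Longrightarrow> radii T i \<subseteq> radii U i"
  by (auto simp: radii_def)

lemma peel_0 [simp]: "peel 0 = S"
  by (simp add: peel_def)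

lemma peel_Suc: "peel (Suc n) = peel n - {x. x extreme_point_of (convex hull (peel n))}"
  by (simp add: peel_def remove_extreme_points_def)

lemma peel_antimono: "m \<le> n \<Longrightarrow> peel n \<subseteq> peel m"
  by (rule lift_Suc_antimono_le[of peel]) (auto simp: peel_Suc)

lemma peel_subset: "peel n \<subseteq> S"
  using peel_antimono[of 0 n] by simp

lemma finite_radii_above:
  assumes "i \<in> I" "s > 0" "T \<subseteq> S"
  shows "finite {r \<in> radii T i. s < r}"
  by (rule finite_subset[OF _ finite_above[OF assms(1,2)]]) (use assms in \<open>auto simp: radii_def\<close>)

lemma count_above_eq: "s > 0 \<Longrightarrow> count_above i s = card {r \<in> radii S i. s < r}"
  by (auto simp: count_above_def radii_def intro!: arg_cong[where f = card])

lemma small_radius_exists: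
  assumes "i \<in> I" "s > 0" "T \<subseteq> S" "infinite (radii T i)"
  shows "\<exists>r\<in>radii T i. r < s"
proof (rule ccontr)
  assume "\<not> ?thesis"
  then have "radii T i \<subseteq> {r \<in> radii T i. s / 2 < r}" using assms(2) by force
  then show False
    using finite_radii_above[of i "s / 2" T] assms finite_subset by auto
qed

text \<open>Since the points of every ray accumulate at the origin, only the outermost one can be extreme.\<close>

lemma inner_point_not_extreme:
  assumes i: "i \<in> I" and T: "T \<subseteq> S" "infinite (radii T i)"
    and r: "r \<in> radii T i" "r' \<in> radii T i" "r < r'"
  shows "\<not> r *\<^sub>R e i extreme_point_of (convex hull T)"
proof -
  \<comment> \<open>A third point, closer to the origin, makes \<open>r\<close> interior to a
    segment.\<close>
  obtain r0 where r0: "r0 \<in> radii T i" "r0 < r"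
    using small_radius_exists[of i r T] i T r by (auto simp: radii_def)
  define t where "t = (r - r0) / (r' - r0)"
  have t: "0 < t" "t < 1" using r0 r by (auto simp: t_def)
  have "t * (r' - r0) = r - r0" using r0 r by (simp add: t_def)
  then have eq: "r = (1 - t) * r0 + t * r'" by (simp add: algebra_simps)
  have "e i \<noteq> 0" using norm_e[OF i] by auto
  then have "r *\<^sub>R e i \<in> open_segment (r0 *\<^sub>R e i) (r' *\<^sub>R e i)"
    using t r r0 by (auto simp: in_segment eq scaleR_add_left intro!: exI[of _ t])
  moreover have "r0 *\<^sub>R e i \<in> convex hull T" "r' *\<^sub>R e i \<in> convex hull T"
    using r r0 by (auto simp: radii_def intro: hull_inc)
  ultimately show ?thesis by (auto simp: extreme_point_of_def)
qed

text \<open>Two different radii lost by a ray in one step would both be extreme, which is impossible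
  for the smaller one. Infinitude of the remaining radii is part of the induction because that
  argument requires a point below the smaller radius.\<close>

lemma peel_invariant:
  assumes i: "i \<in> I"
  shows "infinite (radii (peel n) i) \<and> finite (radii S i - radii (peel n) i) \<and>
    card (radii S i - radii (peel n) i) \<le> n"
proof (induction n)
  case 0
  then show ?case using infinite_ray[OF i] by (simp add: radii_def)
next
  case (Suc n)
  define D where "D = radii (peel n) i - radii (peel (Suc n)) i"
  have "r = r'" if "r \<in> D" "r' \<in> D" for r r'
  proof (rule ccontr)
    assume "r \<noteq> r'"
    moreover have "r *\<^sub>R e i extreme_point_of (convex hull (peel n))"
      "r' *\<^sub>R e i extreme_point_of (convex hull (peel n))"
      using that by (auto simp: D_def radii_def peel_Suc)
    moreover have "r \<in> radii (peel n) i" "r' \<in> radii (peel n) i" using that by (auto simp: D_def)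
    ultimately show False
      using inner_point_not_extreme[OF i peel_subset conjunct1[OF Suc]]
      by (meson linorder_neqE_linordered_idom)
  qed
  then obtain r where "D \<subseteq> {r}" by blast
  then have D: "finite D" "card D \<le> 1"
    using finite_subset[of D "{r}"] card_mono[of "{r}" D] by auto
  have sub: "radii (peel (Suc n)) i \<subseteq> radii (peel n) i" "radii (peel n) i \<subseteq> radii S i"
    by (auto intro!: radii_mono[THEN subsetD] simp: radii_def peel_Suc peel_subset[THEN subsetD])
  then have eq: "radii S i - radii (peel (Suc n)) i = (radii S i - radii (peel n) i) \<union> D"
    "radii (peel n) i = radii (peel (Suc n)) i \<union> D"
    by (auto simp: D_def)
  have "infinite (radii (peel (Suc n)) i)" using Suc eq(2) D by auto
  moreover have "card ((radii S i - radii (peel n) i) \<union> D) \<le> Suc n"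
    using card_Un_le[of "radii S i - radii (peel n) i" D] Suc D by linarith
  ultimately show ?case using Suc D by (simp add: eq(1))
qed

text \<open>With more than \<open>n\<close> radii above \<open>s\<close>, \<open>n\<close> removals
  of at most one radius each cannot exhaust them.\<close>

lemma radius_survives:
  assumes i: "i \<in> I" and s: "s > 0" and n: "n < count_above i s"
  shows "\<exists>r\<in>radii (peel n) i. s < r"
proof (rule ccontr)
  assume "\<not> ?thesis"
  then have "{r \<in> radii S i. s < r} \<subseteq> radii S i - radii (peel n) i" by auto
  then have "count_above i s \<le> card (radii S i - radii (peel n) i)"
    unfolding count_above_eq[OF s] using peel_invariant[OF i, of n] by (intro card_mono) auto
  then show False using peel_invariant[OF i, of n] n by linarith
qed

text \<open>The inner endpoint of the segment used is a remaining point closer to the origin than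
  \<open>s\<close>, available because the ray accumulates there.\<close>

lemma ray_point_in_hull:
  assumes i: "i \<in> I" and r: "r \<in> radii (peel n) i" and s: "0 < s" "s \<le> r"
  shows "s *\<^sub>R e i \<in> convex hull (peel n)"
proof -
  obtain r0 where r0: "r0 \<in> radii (peel n) i" "r0 < s"
    using small_radius_exists[OF i s(1) peel_subset] peel_invariant[OF i] by blast
  define t where "t = (s - r0) / (r - r0)"
  have t: "0 \<le> t" "t \<le> 1" using r0 s by (auto simp: t_def)
  have "t * (r - r0) = s - r0" using r0 s by (simp add: t_def)
  then have "s = (1 - t) * r0 + t * r" by (simp add: algebra_simps)
  then have "s *\<^sub>R e i = (1 - t) *\<^sub>R (r0 *\<^sub>R e i) + t *\<^sub>R (r *\<^sub>R e i)"
    by (simp flip: scaleR_add_left)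
  also have "\<dots> \<in> convex hull (peel n)"
    using t r r0 by (intro convexD[OF convex_convex_hull] hull_inc) (auto simp: radii_def)
  finally show ?thesis .
qed

end

section \<open>Retreat of the outermost points when the reference points are exposed\<close>

locale exposed_configuration = ray_configuration I e S
  for I :: "'i set" and e :: "'i \<Rightarrow> 'a::euclidean_space" and S :: "'a set" +
  fixes b :: "'i \<Rightarrow> real" and u :: "'i \<Rightarrow> 'a" and q :: real
  assumes q: "0 < q" "q < 1"
    and b_pos: "i \<in> I \<Longrightarrow> b i > 0"
    and u_eq: "i \<in> I \<Longrightarrow> u i \<bullet> (b i *\<^sub>R e i) = 1"
    and u_le: "i \<in> I \<Longrightarrow> j \<in> I \<Longrightarrow> j \<noteq> i \<Longrightarrow> u i \<bullet> (b j *\<^sub>R e j) \<le> q"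
begin

text \<open>Radii are measured relative to \<open>b\<close>, so that one number \<open>s\<close>
  controls the extent on all rays at once.\<close>

definition inside_level :: "nat \<Rightarrow> real \<Rightarrow> bool" where
  "inside_level n s \<longleftrightarrow> (\<forall>i\<in>I. \<forall>r\<in>radii (peel n) i. r \<le> s * b i)"

lemma inside_level_mono: "inside_level m s \<Longrightarrow> m \<le> n \<Longrightarrow> s \<le> t \<Longrightarrow> inside_level n t"
  unfolding inside_level_def
proof (intro ballI)
  fix i r assume *: "\<forall>i\<in>I. \<forall>r\<in>radii (peel m) i. r \<le> s * b i" "m \<le> n" "s \<le> t"
    and i: "i \<in> I" and r: "r \<in> radii (peel n) i"
  have "r \<in> radii (peel m) i" using radii_mono[OF peel_antimono[OF *(2)]] r by blast
  then have "r \<le> s * b i" using * i by blast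
  also have "\<dots> \<le> t * b i" using * b_pos[OF i] by (intro mult_right_mono) auto
  finally show "r \<le> t * b i" .
qed

text \<open>On the other rays \<open>u i\<close> is at most \<open>q * s\<close>, which is less than
  \<open>r / b i\<close>, its value at the point in question; on the same ray that point is the
  outermost. Hence \<open>u i\<close> has a unique maximum there.\<close>

lemma outermost_removed:
  assumes wi: "inside_level n s" and i: "i \<in> I" and s: "s > 0"
    and r: "r \<in> radii (peel n) i" "q * s * b i < r"
    and max: "\<And>r'. r' \<in> radii (peel n) i \<Longrightarrow> r' \<le> r"
  shows "r \<notin> radii (peel (Suc n)) i"
proof -
  have ue: "u i \<bullet> e i = 1 / b i" using u_eq[OF i] b_pos[OF i] by (simp add: field_simps)
  have "u i \<bullet> y < u i \<bullet> (r *\<^sub>R e i)" if y: "y \<in> peel n" "y \<noteq> r *\<^sub>R e i" for y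
  proof -
    obtain j t where j: "j \<in> I" "t > 0" "y = t *\<^sub>R e j"
      using on_rays y(1) peel_subset by blast
    have t: "t \<in> radii (peel n) j" using j y by (simp add: radii_def)
    show ?thesis
    proof (cases "j = i")
      case True
      then have "t < r" using max t j y by force
      then show ?thesis using True j b_pos[OF i] by (simp add: ue divide_strict_right_mono)
    next
      case False
      have "u i \<bullet> y = (t / b j) * (u i \<bullet> (b j *\<^sub>R e j))" using b_pos[OF j(1)] by (simp add: j)
      also have "\<dots> \<le> (t / b j) * q"
        using u_le[OF i j(1) False] b_pos[OF j(1)] j(2) by (intro mult_left_mono) auto
      also have "\<dots> \<le> s * q"
        using wi t j(1) b_pos[OF j(1)] q
        by (intro mult_right_mono) (auto simp: inside_level_def pos_divide_le_eq)
      also have "\<dots> < r / b i" using r(2) b_pos[OF i] by (simp add: pos_less_divide_eq mult.commute mult.left_commute)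
      also have "\<dots> = u i \<bullet> (r *\<^sub>R e i)" by (simp add: ue)
      finally show ?thesis .
    qed
  qed
  then have "r *\<^sub>R e i extreme_point_of (convex hull (peel n))"
    using r(1) by (intro extreme_point_of_convex_hull_unique_max) (auto simp: radii_def)
  then show ?thesis by (simp add: radii_def peel_Suc)
qed

text \<open>At stage \<open>n\<close> each ray has at most \<open>L\<close> points beyond level
  \<open>q * s\<close>. While one of them is left, the outermost is removed in every step, so all
  rays are cleared simultaneously within \<open>L\<close> steps.\<close>

lemma inside_level_step:
  assumes wi: "inside_level n s" and s: "s > 0"
    and L: "\<And>i. i \<in> I \<Longrightarrow> count_above i (q * s * b i) - count_above i (s * b i) \<le> L"
  shows "inside_level (n + L) (q * s)"
  unfolding inside_level_def
proof (intro ballI)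
  fix i r assume i: "i \<in> I" and r: "r \<in> radii (peel (n + L)) i"
  define X where "X m = {r \<in> radii (peel m) i. q * s * b i < r}" for m
  have qsb: "q * s * b i > 0" "q * s * b i < s * b i" using q s b_pos[OF i] by auto
  have fin: "finite (X m)" for m
    unfolding X_def by (rule finite_radii_above[OF i qsb(1) peel_subset])
  have "card (X (n + k)) \<le> L - k" for k
  proof (induction k)
    case 0
    \<comment> \<open>The points beyond level \<open>s\<close> are already gone, so only those
      between the two levels are counted.\<close>
    have "X n \<subseteq> {r \<in> radii S i. q * s * b i < r} - {r \<in> radii S i. s * b i < r}"
      using wi i radii_mono[OF peel_subset] by (fastforce simp: X_def inside_level_def)
    then have "card (X n) \<le> card ({r \<in> radii S i. q * s * b i < r} - {r \<in> radii S i. s * b i < r})"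
      using finite_radii_above[OF i qsb(1), of S] by (intro card_mono) auto
    also have "\<dots> = count_above i (q * s * b i) - count_above i (s * b i)"
      using finite_radii_above[OF i _ order_refl] qsb
      by (subst card_Diff_subset) (auto simp: count_above_eq)
    also have "\<dots> \<le> L" by (rule L[OF i])
    finally show ?case by simp
  next
    case (Suc k)
    have sub: "X (n + Suc k) \<subseteq> X (n + k)"
      using radii_mono[OF peel_antimono[of "n + k" "n + Suc k"]] by (auto simp: X_def)
    show ?case
    proof (cases "X (n + k) = {}")
      case True
      then show ?thesis using sub by simp
    next
      case False
      define R where "R = Max (X (n + k))"
      have R: "R \<in> X (n + k)" using False fin by (simp add: R_def)
      have "r' \<le> R" if "r' \<in> radii (peel (n + k)) i" for r'
      proof (cases "r' \<in> X (n + k)")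
        case True
        then show ?thesis using fin by (simp add: R_def)
      next
        case False
        then show ?thesis using that R by (auto simp: X_def)
      qed
      then have "R \<notin> radii (peel (Suc (n + k))) i"
        using R inside_level_mono[OF wi, of "n + k" s]
        by (intro outermost_removed[OF _ i s]) (auto simp: X_def)
      then have "R \<notin> X (n + Suc k)" by (simp add: X_def)
      then have "X (n + Suc k) \<subset> X (n + k)" using sub R by blast
      then have "card (X (n + Suc k)) < card (X (n + k))" using fin by (rule psubset_card_mono[rotated])
      then show ?thesis using Suc by linarith
    qed
  qed
  from this[of L] have "X (n + L) = {}" using fin by simp
  then show "r \<le> q * s * b i" using r by (auto simp: X_def not_less)
qed

text \<open>A qualitative statement without a rate: the initial level is finite, and finitely many
  reductions by the factor \<open>q\<close> bring it below \<open>s\<close>. It supplies the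
  starting stage for the quantitative bound.\<close>

lemma inside_level_eventually:
  assumes "s > 0"
  shows "\<exists>n. inside_level n s"
proof -
  have "\<exists>t. inside_level 0 t \<and> t > 0"
  proof -
    have "\<exists>t>0. \<forall>r\<in>radii S i. r \<le> t * b i" if i: "i \<in> I" for i
    proof -
      have "finite {r \<in> radii S i. 1 < r}" by (rule finite_radii_above[OF i]) auto
      then have "bdd_above {r \<in> radii S i. 1 < r}" by (rule bdd_above_finite)
      then obtain c where c: "\<And>r. r \<in> radii S i \<Longrightarrow> 1 < r \<Longrightarrow> r \<le> c"
        unfolding bdd_above_def by blast
      have "r \<le> max 1 c" if "r \<in> radii S i" for r
        using c[OF that] by (cases "1 < r") auto
      then have "\<forall>r\<in>radii S i. r \<le> max 1 c / b i * b i" using b_pos[OF i] by simp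
      moreover have "max 1 c / b i > 0" using b_pos[OF i] by auto
      ultimately show ?thesis by blast
    qed
    then have "\<forall>i\<in>I. \<exists>t. t > 0 \<and> (\<forall>r\<in>radii S i. r \<le> t * b i)" by blast
    from bchoice[OF this] obtain t where t: "\<And>i. i \<in> I \<Longrightarrow> t i > 0"
        "\<And>i r. i \<in> I \<Longrightarrow> r \<in> radii S i \<Longrightarrow> r \<le> t i * b i"
      by blast
    have "r \<le> (1 + sum t I) * b i" if "i \<in> I" "r \<in> radii S i" for i r
    proof -
      have "t i \<le> sum t I" using that finite_I t(1) by (intro member_le_sum) (auto intro: less_imp_le)
      then have "t i * b i \<le> (1 + sum t I) * b i" using b_pos[OF that(1)] by (intro mult_right_mono) auto
      then show ?thesis using t(2)[OF that] by linarith
    qed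
    moreover have "1 + sum t I > 0" using t(1) by (simp add: add_pos_nonneg less_imp_le sum_nonneg)
    ultimately show ?thesis by (auto simp: inside_level_def)
  qed
  then obtain t where t: "inside_level 0 t" "t > 0" by blast
  have *: "\<exists>n. inside_level n (q ^ m * t)" for m
  proof (induction m)
    case (Suc m)
    then obtain n where n: "inside_level n (q ^ m * t)" by blast
    \<comment> \<open>Any finite bound suffices here, so the counts of all rays are simply
      added.\<close>
    define L where "L = (\<Sum>i\<in>I. count_above i (q * (q ^ m * t) * b i))"
    have "inside_level (n + L) (q * (q ^ m * t))"
    proof (rule inside_level_step[OF n])
      fix i assume "i \<in> I"
      then have "count_above i (q * (q ^ m * t) * b i) \<le> L"
        unfolding L_def using finite_I by (intro member_le_sum) auto
      then show "count_above i (q * (q ^ m * t) * b i) - count_above i (q ^ m * t * b i) \<le> L" by simp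
    qed (use q t in auto)
    then show ?case by (auto simp: mult.assoc)
  qed (use t in auto)
  obtain m where "q ^ m < s / t" using real_arch_pow_inv[of "s / t" q] assms t q by auto
  then have "q ^ m * t \<le> s" using t by (simp add: pos_less_divide_eq)
  then show ?thesis using *[of m] inside_level_mono by blast
qed

end

text \<open>Every point is moved only along its own ray. The displacement of \<open>x\<close> is
  \<open>c - 1\<close> times its image in \<open>B\<close>, so a norm bound on \<open>B\<close>
  controls both suprema.\<close>

lemma hausdorff_distance_le_scaled:
  fixes A B :: "'a::real_normed_vector set"
  assumes ne: "A \<noteq> {}" "B \<noteq> {}" and M: "\<And>y. y \<in> B \<Longrightarrow> norm y \<le> M"
    and c: "c \<ge> 1" "\<And>x. x \<in> A \<Longrightarrow> (1 / c) *\<^sub>R x \<in> B"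
    and \<epsilon>: "\<epsilon> \<ge> 0" "\<And>y. y \<in> B \<Longrightarrow> (1 - \<epsilon>) *\<^sub>R y \<in> A"
  shows "0 \<le> hausdorff_distance A B" "hausdorff_distance A B \<le> max ((c - 1) * M) (\<epsilon> * M)"
proof -
  have AB: "infdist x B \<le> (c - 1) * M" if "x \<in> A" for x
  proof -
    let ?y = "(1 / c) *\<^sub>R x"
    have "(c - 1) *\<^sub>R ?y = (1 - 1 / c) *\<^sub>R x" using c(1) by (simp add: diff_divide_distrib)
    then have "x - ?y = (c - 1) *\<^sub>R ?y" by (simp add: scaleR_diff_left)
    then have "dist x ?y = (c - 1) * norm ?y" using c(1) by (simp add: dist_norm)
    also have "\<dots> \<le> (c - 1) * M" using M[OF c(2)[OF that]] c(1) by (intro mult_left_mono) auto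
    finally show ?thesis using infdist_le2[OF c(2)[OF that]] by blast
  qed
  have BA: "infdist y A \<le> \<epsilon> * M" if "y \<in> B" for y
  proof -
    have "y - (1 - \<epsilon>) *\<^sub>R y = \<epsilon> *\<^sub>R y" by (simp add: algebra_simps)
    then have "dist y ((1 - \<epsilon>) *\<^sub>R y) = \<epsilon> * norm y" using \<epsilon>(1) by (simp add: dist_norm)
    also have "\<dots> \<le> \<epsilon> * M" using M[OF that] \<epsilon>(1) by (intro mult_left_mono) auto
    finally show ?thesis using infdist_le2[OF \<epsilon>(2)[OF that]] by blast
  qed
  \<comment> \<open>A real supremum dominates its terms only when the family is bounded
    above.\<close>
  have "bdd_above ((\<lambda>x. infdist x B) ` A)" using AB by (rule bdd_aboveI2)
  moreover obtain x where "x \<in> A" using ne by blast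
  ultimately have "infdist x B \<le> (SUP x\<in>A. infdist x B)" by (intro cSUP_upper)
  then show "0 \<le> hausdorff_distance A B"
    unfolding hausdorff_distance_def using infdist_nonneg[of x B] by linarith
  show "hausdorff_distance A B \<le> max ((c - 1) * M) (\<epsilon> * M)"
    unfolding hausdorff_distance_def using AB BA ne by (intro max.mono cSUP_least) auto
qed

text \<open>The substitution of \<open>s * t\<close> for \<open>s\<close> makes the counts beyond
  different multiples of the same level comparable.\<close>

lemma tendsto_powr_mult_rescaled:
  fixes f :: "real \<Rightarrow> real"
  assumes lim: "((\<lambda>s. s powr \<alpha> * f s) \<longlongrightarrow> c) (at_right 0)" and t: "t > 0"
  shows "((\<lambda>s. s powr \<alpha> * f (s * t)) \<longlongrightarrow> c * t powr - \<alpha>) (at_right 0)"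
proof -
  have "filterlim (\<lambda>s. s * t) (at_right 0) (at_right 0)"
    using t by real_asymp
  from tendsto_mult_right[OF filterlim_compose[OF lim this], of "t powr - \<alpha>"]
  have "((\<lambda>s. ((s * t) powr \<alpha> * f (s * t)) * t powr - \<alpha>) \<longlongrightarrow> c * t powr - \<alpha>) (at_right 0)" .
  moreover have "\<forall>\<^sub>F s in at_right 0. ((s * t) powr \<alpha> * f (s * t)) * t powr - \<alpha> = s powr \<alpha> * f (s * t)"
    using eventually_at_right_less[of 0]
  proof eventually_elim
    case (elim s)
    then have "(s * t) powr \<alpha> * t powr - \<alpha> = s powr \<alpha>"
      using t by (simp add: powr_mult powr_minus)
    then show ?case by (metis mult.assoc mult.commute)
  qed
  ultimately show ?thesis by (rule Lim_transform_eventually)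
qed

section \<open>Rate of the retreat\<close>

context exposed_configuration
begin

text \<open>
  While the level shrinks from \<open>s\<close> to \<open>q s\<close>, every ray that still reaches beyond level \<open>q s\<close> loses a
  point in each step, so this phase takes about \<open>(q s) powr (- \<alpha>) - s powr (- \<alpha>)\<close> steps; the sum
  over the phases telescopes.
\<close>

lemma inside_level_of_steps:
  fixes \<alpha> \<epsilon> :: real
  assumes \<alpha>: "\<alpha> > 0" and \<epsilon>: "\<epsilon> > 0"
    and lim: "\<And>i. i \<in> I \<Longrightarrow> ((\<lambda>s. s powr \<alpha> * real (count_above i s)) \<longlongrightarrow> c i) (at_right 0)"
    and c: "\<And>i. i \<in> I \<Longrightarrow> c i \<le> b i powr \<alpha>"
  shows "\<exists>s0>0. \<exists>K. \<forall>s n. 0 < s \<longrightarrow> s \<le> s0 \<longrightarrow> (1 + \<epsilon>) * s powr - \<alpha> + K \<le> real n \<longrightarrow> inside_level n s"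
proof -
  define Q where "Q = q powr - \<alpha>"
  have "q powr \<alpha> < 1" using powr_less_mono2[of \<alpha> q 1] q \<alpha> by simp
  moreover have "q powr \<alpha> > 0" using q by simp
  ultimately have Q: "Q > 1" by (simp add: Q_def powr_minus one_less_inverse_iff)
  have "\<forall>\<^sub>F s in at_right 0. \<forall>i\<in>I. real (count_above i (q * s * b i)) - real (count_above i (s * b i))
      \<le> (1 + \<epsilon>) * (Q - 1) * s powr - \<alpha>"
  proof (intro eventually_ball_finite[OF finite_I] ballI)
    fix i assume i: "i \<in> I"
    note b = b_pos[OF i]
    have "((\<lambda>s. s powr \<alpha> * real (count_above i (s * (q * b i))) - s powr \<alpha> * real (count_above i (s * b i)))
        \<longlongrightarrow> c i * (q * b i) powr - \<alpha> - c i * b i powr - \<alpha>) (at_right 0)"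
      using q b by (intro tendsto_diff tendsto_powr_mult_rescaled lim i) auto
    also have "c i * (q * b i) powr - \<alpha> - c i * b i powr - \<alpha> = (c i * b i powr - \<alpha>) * (Q - 1)"
      using q b by (simp add: powr_mult Q_def algebra_simps)
    finally have *: "((\<lambda>s. s powr \<alpha> * real (count_above i (s * (q * b i))) - s powr \<alpha> * real (count_above i (s * b i)))
        \<longlongrightarrow> (c i * b i powr - \<alpha>) * (Q - 1)) (at_right 0)" .
    \<comment> \<open>This is where \<open>c i \<le> b i powr \<alpha>\<close> enters: relative to
      \<open>b i\<close> no ray has asymptotic density above 1, and \<open>\<epsilon>\<close> makes
      the bound strict.\<close>
    have "c i * b i powr - \<alpha> \<le> b i powr \<alpha> * b i powr - \<alpha>" using c[OF i] by (intro mult_right_mono) auto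
    also have "\<dots> < 1 + \<epsilon>" using b \<epsilon> by (simp flip: powr_add)
    finally have "(c i * b i powr - \<alpha>) * (Q - 1) < (1 + \<epsilon>) * (Q - 1)" using Q by simp
    then have "\<forall>\<^sub>F s in at_right 0. s powr \<alpha> * real (count_above i (s * (q * b i)))
        - s powr \<alpha> * real (count_above i (s * b i)) < (1 + \<epsilon>) * (Q - 1)"
      by (rule order_tendstoD(2)[OF *])
    then show "\<forall>\<^sub>F s in at_right 0. real (count_above i (q * s * b i)) - real (count_above i (s * b i))
      \<le> (1 + \<epsilon>) * (Q - 1) * s powr - \<alpha>"
      using eventually_at_right_less[of 0]
    proof eventually_elim
      case (elim s)
      have "s powr \<alpha> * (real (count_above i (q * s * b i)) - real (count_above i (s * b i))) < (1 + \<epsilon>) * (Q - 1)"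
        using elim(1) by (simp add: right_diff_distrib mult_ac)
      then show ?case using elim(2) by (simp add: powr_minus field_simps)
    qed
  qed
  then obtain s1 where s1: "s1 > 0" "\<And>s i. 0 < s \<Longrightarrow> s < s1 \<Longrightarrow> i \<in> I \<Longrightarrow>
      real (count_above i (q * s * b i)) - real (count_above i (s * b i)) \<le> (1 + \<epsilon>) * (Q - 1) * s powr - \<alpha>"
    unfolding eventually_at_right_field by blast
  define s0 where "s0 = s1 / 2"
  have s0: "s0 > 0" "s0 < s1" using s1 by (auto simp: s0_def)
  \<comment> \<open>The cost of reaching the range of \<open>s\<close> in which the asymptotic
    estimate is valid; it becomes the additive constant.\<close>
  obtain K where K: "inside_level K (q * s0)" using inside_level_eventually[of "q * s0"] q s0 by auto
  \<comment> \<open>Induction on the number of phases separating \<open>s\<close> from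
    \<open>s0\<close>; levels above \<open>q * s0\<close> are already covered by
    \<open>K\<close>.\<close>
  have *: "inside_level n s" if "0 < s" "q ^ Suc m * s0 \<le> s" "s \<le> s0" "(1 + \<epsilon>) * s powr - \<alpha> + K \<le> real n" for s m n
    using that
  proof (induction m arbitrary: s n)
    case 0
    have "0 \<le> (1 + \<epsilon>) * s powr - \<alpha>" using \<epsilon> by simp
    then have "K \<le> n" using 0 by linarith
    then show ?case using inside_level_mono[OF K] 0 by simp
  next
    case (Suc m)
    show ?case
    proof (cases "s \<le> q * s0")
      case False
      have "0 \<le> (1 + \<epsilon>) * s powr - \<alpha>" using \<epsilon> by simp
      then have "K \<le> n" using Suc by linarith
      then show ?thesis using inside_level_mono[OF K] False by simp
    next
      case True
      define t where "t = s / q"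
      have t: "s = q * t" "t > 0" "t \<le> s0" "q ^ Suc m * s0 \<le> t"
        using Suc.prems True q by (auto simp: t_def pos_divide_le_eq pos_le_divide_eq mult_ac)
      \<comment> \<open>The maximum, and not the sum, gives the right constant, since all rays
        retreat during the same steps. The element 0 covers an empty \<open>I\<close>.\<close>
      define L where "L = Max ((\<lambda>i. count_above i (q * t * b i) - count_above i (t * b i)) ` I \<union> {0})"
      have L_ge: "count_above i (q * t * b i) - count_above i (t * b i) \<le> L" if "i \<in> I" for i
        unfolding L_def using finite_I that by (intro Max_ge) auto
      have "L \<in> (\<lambda>i. count_above i (q * t * b i) - count_above i (t * b i)) ` I \<union> {0}"
        unfolding L_def using finite_I by (intro Max_in) auto
      then have L: "real L \<le> (1 + \<epsilon>) * (Q - 1) * t powr - \<alpha>"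
      proof
        assume "L \<in> (\<lambda>i. count_above i (q * t * b i) - count_above i (t * b i)) ` I"
        then obtain i where i: "i \<in> I" "L = count_above i (q * t * b i) - count_above i (t * b i)" by blast
        show ?thesis
        \<comment> \<open>The counts are subtracted as natural numbers; in the second case the
          difference is 0.\<close>
        proof (cases "count_above i (t * b i) \<le> count_above i (q * t * b i)")
          case True
          then show ?thesis using s1(2)[of t i] t s0 i by (simp add: of_nat_diff)
        next
          case False
          then show ?thesis using i \<epsilon> Q by simp
        qed
      qed (use \<epsilon> Q in simp)
      \<comment> \<open>The telescoping: the budget for level \<open>t\<close> plus the bound on
        \<open>L\<close> equals the budget for level \<open>s\<close>.\<close>
      have "s powr - \<alpha> = Q * t powr - \<alpha>"
        using q t by (simp add: Q_def powr_mult)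
      then have sum: "(1 + \<epsilon>) * t powr - \<alpha> + K + (1 + \<epsilon>) * (Q - 1) * t powr - \<alpha> \<le> real n"
        using Suc.prems by (simp add: algebra_simps)
      have "0 \<le> (1 + \<epsilon>) * t powr - \<alpha>" using \<epsilon> by simp
      then have "real L \<le> real n" using sum L by linarith
      then have "L \<le> n" by simp
      then have "(1 + \<epsilon>) * t powr - \<alpha> + K \<le> real (n - L)" using sum L by (simp add: of_nat_diff)
      then have "inside_level (n - L) t" using Suc.IH[OF t(2,4,3)] by blast
      from inside_level_step[OF this t(2) L_ge] have "inside_level (n - L + L) (q * t)" by simp
      then show ?thesis using \<open>L \<le> n\<close> t by simp
    qed
  qed
  have "inside_level n s" if s: "0 < s" "s \<le> s0" "(1 + \<epsilon>) * s powr - \<alpha> + K \<le> real n" for s n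
  proof -
    obtain m where "q ^ m < s / s0" using real_arch_pow_inv[of "s / s0" q] s s0 q by auto
    then have "q ^ m * s0 \<le> s" using s0 by (simp add: pos_less_divide_eq)
    moreover have "q ^ Suc m * s0 \<le> q ^ m * s0" using q s0 by simp
    ultimately show ?thesis using *[of s m n] s by linarith
  qed
  then show ?thesis using s0(1) by blast
qed

text \<open>The step bound is applied with \<open>\<epsilon> / 2\<close>. At the level in question
  \<open>s powr - \<alpha>\<close> is \<open>k / (1 + \<epsilon>)\<close>, which leaves a reserve
  linear in \<open>k\<close> that absorbs both \<open>K\<close> and the shift from \<open>k\<close>
  to \<open>k - 1\<close>.\<close>

lemma eventually_inside_level:
  fixes \<alpha> \<epsilon> :: real
  assumes \<alpha>: "\<alpha> > 0" and \<epsilon>: "\<epsilon> > 0"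
    and lim: "\<And>i. i \<in> I \<Longrightarrow> ((\<lambda>s. s powr \<alpha> * real (count_above i s)) \<longlongrightarrow> c i) (at_right 0)"
    and c: "\<And>i. i \<in> I \<Longrightarrow> c i \<le> b i powr \<alpha>"
  shows "\<forall>\<^sub>F k in sequentially. inside_level (k - 1) (((1 + \<epsilon>) / real k) powr (1 / \<alpha>))"
proof -
  obtain s0 K where s0: "s0 > 0" and K: "\<And>s n. 0 < s \<Longrightarrow> s \<le> s0 \<Longrightarrow>
      (1 + \<epsilon> / 2) * s powr - \<alpha> + K \<le> real n \<Longrightarrow> inside_level n s"
    using inside_level_of_steps[OF \<alpha> _ lim c, of "\<epsilon> / 2"] \<epsilon> by auto
  have "(\<lambda>k::nat. ((1 + \<epsilon>) / real k) powr (1 / \<alpha>)) \<longlonglongrightarrow> 0"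
    using \<alpha> \<epsilon> by real_asymp
  then have "\<forall>\<^sub>F k in sequentially. ((1 + \<epsilon>) / real k) powr (1 / \<alpha>) < s0"
    using s0 by (rule order_tendstoD)
  moreover have "\<forall>\<^sub>F k::nat in sequentially. real k \<ge> (1 + \<bar>K\<bar>) * (1 + \<epsilon>) / (\<epsilon> / 2)"
    by real_asymp
  ultimately show ?thesis using eventually_gt_at_top[of 0]
  proof eventually_elim
    case (elim k)
    define s where "s = ((1 + \<epsilon>) / real k) powr (1 / \<alpha>)"
    have s: "s > 0" "s \<le> s0" using elim \<epsilon> by (auto simp: s_def)
    have "s powr - \<alpha> = ((1 + \<epsilon>) / real k) powr - 1" using \<alpha> by (simp add: s_def powr_powr)
    also have "\<dots> = real k / (1 + \<epsilon>)" using elim \<epsilon> by (simp add: powr_minus)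
    finally have P: "s powr - \<alpha> = real k / (1 + \<epsilon>)" .
    have "(1 + \<epsilon> / 2) * s powr - \<alpha> = real k - (\<epsilon> / 2) * real k / (1 + \<epsilon>)"
      unfolding P using \<epsilon> by (simp add: field_simps)
    moreover have "1 + \<bar>K\<bar> \<le> (\<epsilon> / 2) * real k / (1 + \<epsilon>)"
      using elim(2) \<epsilon> by (simp add: field_simps)
    ultimately have "(1 + \<epsilon> / 2) * s powr - \<alpha> + K \<le> real (k - 1)"
      using elim(3) by (simp add: of_nat_diff)
    then show ?case using K[OF s] by (simp add: s_def)
  qed
qed

end

section \<open>Two-sided bounds and convergence of the rescaled hulls\<close>

context ray_configuration
begin

text \<open>The radius is chosen so that its power \<open>\<alpha>\<close> is
  \<open>(1 - \<epsilon>) powr \<alpha> * c / k\<close>. Eventually more than \<open>k\<close>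
  points of the ray lie beyond it, and \<open>k - 1\<close> removals leave at least one of
  them.\<close>

lemma eventually_scaled_point_in_peeled_hull:
  fixes \<alpha> \<epsilon> :: real
  assumes \<alpha>: "\<alpha> > 0" and \<epsilon>: "0 < \<epsilon>" "\<epsilon> < 1" and i: "i \<in> I" and c: "c > 0"
    and lim: "((\<lambda>s. s powr \<alpha> * real (count_above i s)) \<longlongrightarrow> c) (at_right 0)"
  shows "\<forall>\<^sub>F k in sequentially. ((1 - \<epsilon>) * c powr (1 / \<alpha>) * real k powr - (1 / \<alpha>)) *\<^sub>R e i
    \<in> convex hull (peel (k - 1))"
proof -
  define s where "s k = (1 - \<epsilon>) * c powr (1 / \<alpha>) * real k powr - (1 / \<alpha>)" for k :: nat
  have "(1 - \<epsilon>) powr \<alpha> < 1" using powr_less_mono2[of \<alpha> "1 - \<epsilon>" 1] \<epsilon> \<alpha> by simp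
  then have "(1 - \<epsilon>) powr \<alpha> * c < c" using c by simp
  then have "\<forall>\<^sub>F s in at_right 0. (1 - \<epsilon>) powr \<alpha> * c < s powr \<alpha> * real (count_above i s)"
    by (rule order_tendstoD(1)[OF lim])
  moreover have "filterlim s (at_right 0) sequentially"
  proof -
    define C where "C = (1 - \<epsilon>) * c powr (1 / \<alpha>)"
    have "C > 0" using \<epsilon> c by (simp add: C_def)
    then have "filterlim (\<lambda>k::nat. C * real k powr - (1 / \<alpha>)) (at_right 0) sequentially"
      using \<alpha> by real_asymp
    then show ?thesis by (simp add: s_def[abs_def] C_def)
  qed
  ultimately have "\<forall>\<^sub>F k in sequentially. (1 - \<epsilon>) powr \<alpha> * c < s k powr \<alpha> * real (count_above i (s k))"
    by (rule eventually_compose_filterlim)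
  then show ?thesis using eventually_gt_at_top[of 0]
  proof eventually_elim
    case (elim k)
    have s: "s k > 0" using elim \<epsilon> c by (simp add: s_def)
    have "s k powr \<alpha> = (1 - \<epsilon>) powr \<alpha> * c / real k"
    proof -
      have "(real k powr - (1 / \<alpha>)) powr \<alpha> = real k powr (- (1 / \<alpha>) * \<alpha>)" by (rule powr_powr)
      also have "\<dots> = 1 / real k" using elim \<alpha> by (simp add: powr_minus divide_inverse)
      finally have "(real k powr - (1 / \<alpha>)) powr \<alpha> = 1 / real k" .
      moreover have "(c powr (1 / \<alpha>)) powr \<alpha> = c" using c \<alpha> by (simp add: powr_powr)
      ultimately show ?thesis using \<epsilon> c by (simp add: s_def powr_mult del: powr_powr)
    qed
    then have "(1 - \<epsilon>) powr \<alpha> * c * 1 < (1 - \<epsilon>) powr \<alpha> * c * (real (count_above i (s k)) / real k)"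
      using elim(1) by simp
    moreover have "(1 - \<epsilon>) powr \<alpha> * c > 0" using \<epsilon> c by simp
    ultimately have "1 < real (count_above i (s k)) / real k"
      by (simp only: mult_less_cancel_left_pos)
    then have "k < count_above i (s k)" using elim by simp
    then have "k - 1 < count_above i (s k)" by linarith
    then obtain r where "r \<in> radii (peel (k - 1)) i" "s k < r"
      using radius_survives[OF i s] by blast
    then show ?case using ray_point_in_hull[OF i _ s] by (simp add: s_def)
  qed
qed

text \<open>One factor \<open>1 + \<epsilon>\<close> is the price for exposing all points
  \<open>b i *\<^sub>R e i\<close>, the factor \<open>(1 + \<epsilon>) powr (1 / \<alpha>)\<close>
  the price in the level reached after \<open>k - 1\<close> steps.\<close>

lemma eventually_peel_subset_scaled:
  fixes \<alpha> \<epsilon> :: real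
  defines "C \<equiv> \<lambda>c. convex hull ((\<lambda>i. c i powr (1 / \<alpha>) *\<^sub>R e i) ` I)"
  assumes \<alpha>: "\<alpha> > 0" and \<epsilon>: "\<epsilon> > 0" and ne: "I \<noteq> {}" and c: "\<And>i. i \<in> I \<Longrightarrow> c i > 0" and 0: "0 \<in> C c"
    and lim: "\<And>i. i \<in> I \<Longrightarrow> ((\<lambda>s. s powr \<alpha> * real (count_above i s)) \<longlongrightarrow> c i) (at_right 0)"
  shows "\<forall>\<^sub>F k in sequentially. \<forall>x\<in>peel (k - 1).
    (1 / ((1 + \<epsilon>) * (1 + \<epsilon>) powr (1 / \<alpha>))) *\<^sub>R (real k powr (1 / \<alpha>) *\<^sub>R x) \<in> C c"
proof -
  obtain b u q where q: "0 < q" "q < (1::real)"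
    and b: "\<And>i. i \<in> I \<Longrightarrow> c i powr (1 / \<alpha>) \<le> b i" "\<And>i. i \<in> I \<Longrightarrow> (b i / (1 + \<epsilon>)) *\<^sub>R e i \<in> C c"
    and u: "\<And>i. i \<in> I \<Longrightarrow> u i \<bullet> (b i *\<^sub>R e i) = 1"
      "\<And>i j. i \<in> I \<Longrightarrow> j \<in> I \<Longrightarrow> j \<noteq> i \<Longrightarrow> u i \<bullet> (b j *\<^sub>R e j) \<le> q"
    using exposing_functionals_exist[of I e "\<lambda>i. c i powr (1 / \<alpha>)" \<epsilon>] finite_I ne norm_e inj_e c 0 \<epsilon>
    unfolding C_def by (smt (verit, best) powr_gt_zero)
  have b_pos: "b i > 0" if "i \<in> I" for i
    using b(1)[OF that] c[OF that] by (smt (verit) powr_gt_zero)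
  interpret exposed_configuration I e S b u q
    by unfold_locales (use q b_pos u in auto)
  have cb: "c i \<le> b i powr \<alpha>" if "i \<in> I" for i
  proof -
    have "c i = (c i powr (1 / \<alpha>)) powr \<alpha>" using c[OF that] \<alpha> by (simp add: powr_powr)
    also have "\<dots> \<le> b i powr \<alpha>" using b(1)[OF that] \<alpha> by (intro powr_mono2) auto
    finally show ?thesis .
  qed
  have "\<forall>\<^sub>F k in sequentially. inside_level (k - 1) (((1 + \<epsilon>) / real k) powr (1 / \<alpha>))"
    using \<alpha> \<epsilon> lim cb by (rule eventually_inside_level)
  then show ?thesis using eventually_gt_at_top[of 0]
  proof eventually_elim
    case (elim k)
    show ?case
    proof
      fix x assume x: "x \<in> peel (k - 1)"
      then obtain i r where ir: "i \<in> I" "r > 0" "x = r *\<^sub>R e i"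
        using on_rays peel_subset by blast
      define E where "E = (1 + \<epsilon>) powr (1 / \<alpha>)"
      have "E > 0" using \<epsilon> by (simp add: E_def)
      have "r \<in> radii (peel (k - 1)) i" using ir x by (simp add: radii_def)
      then have "r \<le> ((1 + \<epsilon>) / real k) powr (1 / \<alpha>) * b i"
        using elim ir by (auto simp: inside_level_def)
      also have "((1 + \<epsilon>) / real k) powr (1 / \<alpha>) = E / real k powr (1 / \<alpha>)"
        using \<epsilon> by (simp add: powr_divide E_def)
      finally have "real k powr (1 / \<alpha>) * r \<le> E * b i" using elim by (simp add: field_simps)
      then have "(1 / ((1 + \<epsilon>) * E)) * (real k powr (1 / \<alpha>) * r) \<le> (1 / ((1 + \<epsilon>) * E)) * (E * b i)"
        using \<epsilon> \<open>E > 0\<close> by (intro mult_left_mono) auto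
      also have "\<dots> = b i / (1 + \<epsilon>)" using \<open>E > 0\<close> by simp
      finally have le: "(1 / ((1 + \<epsilon>) * E)) * (real k powr (1 / \<alpha>) * r) \<le> b i / (1 + \<epsilon>)" .
      have "((1 / ((1 + \<epsilon>) * E)) * (real k powr (1 / \<alpha>) * r)) *\<^sub>R e i \<in> C c"
        by (rule scaleR_in_convex_antimono[OF _ 0 b(2)[OF ir(1)] _ le])
          (use \<epsilon> ir \<open>E > 0\<close> in \<open>auto simp: C_def\<close>)
      then show "(1 / ((1 + \<epsilon>) * (1 + \<epsilon>) powr (1 / \<alpha>))) *\<^sub>R (real k powr (1 / \<alpha>) *\<^sub>R x) \<in> C c"
        by (simp add: ir E_def)
    qed
  qed
qed

text \<open>For fixed \<open>\<epsilon>\<close> the rescaled hull \<open>D k\<close> eventually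
  contains \<open>(1 - \<epsilon>)\<close> times \<open>C\<close> and is contained in
  \<open>d\<close> times \<open>C\<close>. This bounds the distance by
  \<open>\<phi> \<epsilon>\<close>, which vanishes with \<open>\<epsilon>\<close>.\<close>

lemma peeling_hull_tendsto:
  fixes \<alpha> :: real
  assumes \<alpha>: "\<alpha> > 0" and ne: "I \<noteq> {}" and c: "\<And>i. i \<in> I \<Longrightarrow> c i > 0"
    and cone: "convex_cone hull (e ` I) = UNIV"
    and lim: "\<And>i. i \<in> I \<Longrightarrow> ((\<lambda>s. s powr \<alpha> * real (count_above i s)) \<longlongrightarrow> c i) (at_right 0)"
  shows "(\<lambda>k. hausdorff_distance ((\<lambda>x. real k powr (1 / \<alpha>) *\<^sub>R x) ` peeling_hull S k)
    (convex hull ((\<lambda>i. c i powr (1 / \<alpha>) *\<^sub>R e i) ` I))) \<longlonglongrightarrow> 0"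
proof -
  define C where "C = convex hull ((\<lambda>i. c i powr (1 / \<alpha>) *\<^sub>R e i) ` I)"
  define D where "D k = (\<lambda>x. real k powr (1 / \<alpha>) *\<^sub>R x) ` peeling_hull S k" for k
  have 0: "0 \<in> C" unfolding C_def
  proof (rule zero_in_convex_hull_if_positively_spanning[OF finite_I _ cone])
    show "c i powr (1 / \<alpha>) > 0" if "i \<in> I" for i using c[OF that] by simp
  qed
  have "compact C" unfolding C_def using finite_I by (intro finite_imp_compact_convex_hull) auto
  then have "bounded C" by (rule compact_imp_bounded)
  then obtain M where M: "\<And>y. y \<in> C \<Longrightarrow> norm y \<le> M"
    unfolding bounded_iff by blast
  define \<phi> where "\<phi> \<epsilon> = max (((1 + \<epsilon>) * (1 + \<epsilon>) powr (1 / \<alpha>) - 1) * M) (\<epsilon> * M)" for \<epsilon> :: real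
  have *: "\<forall>\<^sub>F k in sequentially. 0 \<le> hausdorff_distance (D k) C \<and> hausdorff_distance (D k) C \<le> \<phi> \<epsilon>"
    if \<epsilon>: "0 < \<epsilon>" "\<epsilon> < 1" for \<epsilon>
  proof -
    define d where "d = (1 + \<epsilon>) * (1 + \<epsilon>) powr (1 / \<alpha>)"
    have d: "d \<ge> 1"
    proof -
      have "1 * 1 \<le> (1 + \<epsilon>) * (1 + \<epsilon>) powr (1 / \<alpha>)"
        using \<epsilon> \<alpha> by (intro mult_mono ge_one_powr_ge_zero) auto
      then show ?thesis by (simp add: d_def)
    qed
    have "\<forall>\<^sub>F k in sequentially. \<forall>i\<in>I. ((1 - \<epsilon>) * c i powr (1 / \<alpha>) * real k powr - (1 / \<alpha>)) *\<^sub>R e i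
        \<in> convex hull (peel (k - 1))"
      using eventually_scaled_point_in_peeled_hull[OF \<alpha> \<epsilon> _ c lim]
      by (intro eventually_ball_finite finite_I ballI) auto
    moreover have "\<forall>\<^sub>F k in sequentially. \<forall>x\<in>peel (k - 1). (1 / d) *\<^sub>R (real k powr (1 / \<alpha>) *\<^sub>R x) \<in> C"
      unfolding d_def C_def using \<alpha> \<epsilon>(1) ne c 0[unfolded C_def] lim
      by (rule eventually_peel_subset_scaled)
    ultimately show ?thesis using eventually_gt_at_top[of 0]
    proof eventually_elim
      case (elim k)
      define t where "t = real k powr (1 / \<alpha>)"
      have t: "t > 0" "real k powr - (1 / \<alpha>) = 1 / t"
        using elim(3) by (auto simp: t_def powr_minus divide_inverse)
      have D: "D k = (\<lambda>x. t *\<^sub>R x) ` (convex hull (peel (k - 1)))"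
        by (simp add: D_def peeling_hull_def peel_def t_def)
      have "convex (D k)" unfolding D by (intro convex_scaling convex_convex_hull)
      \<comment> \<open>Preimages of convex sets under a scaling are convex, so both inclusions need
        checking only on generating points.\<close>
      have sub1: "convex hull (peel (k - 1)) \<subseteq> (\<lambda>x. (t / d) *\<^sub>R x) -` C"
        using elim(2) by (intro hull_minimal convex_linear_vimage) (auto simp: C_def t_def linear_scaleR)
      have "C \<subseteq> (\<lambda>x. (1 - \<epsilon>) *\<^sub>R x) -` D k"
        unfolding C_def
      proof (intro hull_minimal convex_linear_vimage \<open>convex (D k)\<close> linear_scaleR subsetI)
        fix x assume "x \<in> (\<lambda>i. c i powr (1 / \<alpha>) *\<^sub>R e i) ` I"
        then obtain i where i: "i \<in> I" "x = c i powr (1 / \<alpha>) *\<^sub>R e i" by blast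
        have "(1 - \<epsilon>) *\<^sub>R x = t *\<^sub>R (((1 - \<epsilon>) * c i powr (1 / \<alpha>) * real k powr - (1 / \<alpha>)) *\<^sub>R e i)"
          using t by (simp add: i)
        also have "\<dots> \<in> D k" unfolding D using elim(1) i by blast
        finally show "x \<in> (\<lambda>x. (1 - \<epsilon>) *\<^sub>R x) -` D k" by simp
      qed
      then have CD: "(1 - \<epsilon>) *\<^sub>R y \<in> D k" if "y \<in> C" for y using that by blast
      have DC: "(1 / d) *\<^sub>R x \<in> C" if "x \<in> D k" for x
        using that sub1 by (auto simp: D)
      have ne': "D k \<noteq> {}" "C \<noteq> {}" using 0 CD by auto
      show ?case
        using hausdorff_distance_le_scaled[OF ne' M d DC less_imp_le[OF \<epsilon>(1)] CD]
        by (simp add: \<phi>_def d_def)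
    qed
  qed
  have "(\<phi> \<longlongrightarrow> max (((1 + 0) * (1 + 0) powr (1 / \<alpha>) - 1) * M) (0 * M)) (at_right 0)"
    unfolding \<phi>_def by (intro tendsto_intros) auto
  then have \<phi>: "(\<phi> \<longlongrightarrow> 0) (at_right 0)" by simp
  have "\<forall>\<^sub>F k in sequentially. dist (hausdorff_distance (D k) C) 0 < \<eta>" if "\<eta> > 0" for \<eta>
  proof -
    have "\<forall>\<^sub>F \<epsilon> in at_right 0. \<phi> \<epsilon> < \<eta> \<and> 0 < \<epsilon> \<and> \<epsilon> < 1"
      using order_tendstoD(2)[OF \<phi> that] eventually_at_right_real[of 0 "1::real"]
      by (auto elim: eventually_elim2)
    then obtain \<epsilon> where "\<phi> \<epsilon> < \<eta>" "0 < \<epsilon>" "\<epsilon> < 1"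
      using eventually_happens by force
    from *[OF this(2,3)] show ?thesis
      by (rule eventually_mono) (use \<open>\<phi> \<epsilon> < \<eta>\<close> in \<open>simp add: dist_real_def\<close>)
  qed
  then have "(\<lambda>k. hausdorff_distance (D k) C) \<longlonglongrightarrow> 0" by (rule tendstoI)
  then show ?thesis by (simp add: D_def C_def)
qed

end

section \<open>Asymptotics of Poisson counts\<close>

text \<open>The weights satisfy \<open>Suc n * p (Suc n) = m * p n\<close>, which reduces the first
  two factorial moments to the exponential series. The square is the combination
  \<open>n * (n - 1) + (1 - 2 * m) * n + m\<^sup>2\<close>.\<close>

lemma poisson_second_central_moment:
  fixes m :: real
  shows "(\<lambda>n. (real n - m)\<^sup>2 * (m ^ n / fact n * exp (- m))) sums m"
proof -
  define p where "p n = m ^ n / fact n" for n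
  have p: "p sums exp m"
    using exp_converges[of m] by (simp add: p_def[abs_def] divide_inverse mult.commute)
  have shift: "real (Suc n) * p (Suc n) = m * p n" for n
    by (simp add: p_def del: of_nat_Suc)
  have p1: "(\<lambda>n. real n * p n) sums (m * exp m)"
    using sums_mult[OF p, of m] sums_Suc_iff[of "\<lambda>n. real n * p n" "m * exp m"] by (simp add: shift del: of_nat_Suc)
  have "real (Suc n) * (real (Suc n) - 1) * p (Suc n) = m * (real n * p n)" for n
  proof -
    have "real (Suc n) * (real (Suc n) - 1) * p (Suc n) = real n * (real (Suc n) * p (Suc n))"
      by (simp add: algebra_simps)
    also have "\<dots> = m * (real n * p n)" unfolding shift by simp
    finally show ?thesis .
  qed
  then have "(\<lambda>n. real (Suc n) * (real (Suc n) - 1) * p (Suc n)) sums (m * (m * exp m))"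
    using sums_mult[OF p1, of m] by (simp only:)
  then have p2: "(\<lambda>n. real n * (real n - 1) * p n) sums (m * (m * exp m))"
    using sums_Suc_iff[of "\<lambda>n. real n * (real n - 1) * p n" "m * (m * exp m)"] by simp
  have "(\<lambda>n. exp (- m) * (real n * (real n - 1) * p n + (1 - 2 * m) * (real n * p n) + m\<^sup>2 * p n)) sums
      (exp (- m) * (m * (m * exp m) + (1 - 2 * m) * (m * exp m) + m\<^sup>2 * exp m))"
    by (intro sums_mult sums_add p p1 p2)
  moreover have "exp (- m) * (m * (m * exp m) + (1 - 2 * m) * (m * exp m) + m\<^sup>2 * exp m) =
      (exp (- m) * exp m) * m"
    by (simp add: power2_eq_square algebra_simps)
  moreover have "exp (- m) * exp m = 1" by (simp flip: exp_add)
  moreover have "exp (- m) * (real n * (real n - 1) * p n + (1 - 2 * m) * (real n * p n) + m\<^sup>2 * p n) =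
      (real n - m)\<^sup>2 * (p n * exp (- m))" for n
    by (simp add: power2_eq_square algebra_simps)
  ultimately show ?thesis by (simp only: p_def mult_1_left)
qed

text \<open>The bad event also contains outcomes where \<open>X\<close> is infinite or not a natural
  number. Since the weights sum to 1, its probability is the sum of \<open>p n - prob (A n)\<close>,
  which is compared termwise with the second central moment.\<close>

lemma (in prob_space) poisson_chebyshev:
  fixes X :: "'a \<Rightarrow> ennreal"
  assumes X: "X \<in> borel_measurable M" and c: "c > 0"
    and dist: "\<And>n::nat. prob {\<omega> \<in> space M. X \<omega> = of_nat n} = m ^ n / fact n * exp (- m)"
  shows "{\<omega> \<in> space M. \<not> (\<exists>n. X \<omega> = of_nat n \<and> \<bar>real n - m\<bar> < c)} \<in> events"
    and "prob {\<omega> \<in> space M. \<not> (\<exists>n. X \<omega> = of_nat n \<and> \<bar>real n - m\<bar> < c)} \<le> m / c\<^sup>2"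
proof -
  define p where "p n = m ^ n / fact n * exp (- m)" for n
  define A where "A n = {\<omega> \<in> space M. X \<omega> = of_nat n \<and> \<bar>real n - m\<bar> < c}" for n
  have A: "A n \<in> events" for n unfolding A_def using X by measurable
  have eq: "{\<omega> \<in> space M. \<not> (\<exists>n. X \<omega> = of_nat n \<and> \<bar>real n - m\<bar> < c)} = space M - (\<Union>n. A n)"
    by (auto simp: A_def)
  then show "{\<omega> \<in> space M. \<not> (\<exists>n. X \<omega> = of_nat n \<and> \<bar>real n - m\<bar> < c)} \<in> events"
    using A by auto
  have "disjoint_family A"
    by (auto simp: disjoint_family_on_def A_def)
  then have "(\<lambda>n. prob (A n)) sums prob (\<Union>n. A n)"
    using A by (intro finite_measure_UNION) auto
  moreover have "p sums 1"
  proof -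
    have "(\<lambda>n. exp (- m) * (m ^ n / fact n)) sums (exp (- m) * exp m)"
      using exp_converges[of m] by (intro sums_mult) (simp add: divide_inverse mult.commute)
    then show ?thesis by (simp add: p_def[abs_def] exp_minus mult.commute)
  qed
  ultimately have "(\<lambda>n. p n - prob (A n)) sums (1 - prob (\<Union>n. A n))"
    by (intro sums_diff)
  moreover have "(\<lambda>n. (real n - m)\<^sup>2 * p n / c\<^sup>2) sums (m / c\<^sup>2)"
    unfolding p_def by (intro sums_divide poisson_second_central_moment)
  moreover have "p n - prob (A n) \<le> (real n - m)\<^sup>2 * p n / c\<^sup>2" for n
  proof (cases "\<bar>real n - m\<bar> < c")
    case True
    have "p n \<ge> 0" unfolding p_def dist[symmetric] by (rule measure_nonneg)
    moreover have "prob (A n) = p n" using True dist[of n] by (simp add: A_def p_def)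
    ultimately show ?thesis by simp
  next
    case False
    have "p n \<ge> 0" unfolding p_def dist[symmetric] by (rule measure_nonneg)
    have "c\<^sup>2 \<le> (real n - m)\<^sup>2" using False c by (simp add: abs_le_square_iff[symmetric])
    then have "1 \<le> (real n - m)\<^sup>2 / c\<^sup>2" using c by simp
    then have "1 * p n \<le> (real n - m)\<^sup>2 / c\<^sup>2 * p n" using \<open>p n \<ge> 0\<close> by (rule mult_right_mono)
    moreover have "prob (A n) = 0" using False by (simp add: A_def)
    ultimately show ?thesis by simp
  qed
  ultimately have "1 - prob (\<Union>n. A n) \<le> m / c\<^sup>2" by (meson sums_le)
  moreover have "prob (space M - (\<Union>n. A n)) = 1 - prob (\<Union>n. A n)"
    using A by (intro prob_compl) auto
  ultimately show "prob {\<omega> \<in> space M. \<not> (\<exists>n. X \<omega> = of_nat n \<and> \<bar>real n - m\<bar> < c)} \<le> m / c\<^sup>2"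
    unfolding eq by simp
qed

lemma emeasure_pareto_intensity_greaterThan:
  assumes "\<alpha> > 0" "s > 0"
  shows "emeasure (pareto_intensity \<alpha>) {s<..} = ennreal (s powr - \<alpha>)"
proof -
  have "(\<lambda>r. ennreal (\<alpha> * r powr (- \<alpha> - 1))) \<in> borel_measurable (restrict_space lborel {0<..})"
    by (rule measurable_restrict_space1) simp
  moreover have "{s<..} \<in> sets (restrict_space lborel {0<..})"
    using assms by (auto simp: sets_restrict_space intro!: image_eqI[of _ _ "{s<..}"])
  ultimately have "emeasure (pareto_intensity \<alpha>) {s<..} =
      (\<integral>\<^sup>+r. ennreal (\<alpha> * r powr (- \<alpha> - 1)) * indicator {s<..} r \<partial>restrict_space lborel {0<..})"
    unfolding pareto_intensity_def by (rule emeasure_density)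
  also have "\<dots> = (\<integral>\<^sup>+r. ennreal (\<alpha> * r powr (- \<alpha> - 1)) * indicator {s<..} r * indicator {0<..} r \<partial>lborel)"
    by (rule nn_integral_restrict_space) simp
  also have "\<dots> = (\<integral>\<^sup>+r. ennreal (\<alpha> * r powr (- \<alpha> - 1)) * indicator {s..} r \<partial>lborel)"
  proof (rule nn_integral_cong_AE)
    show "AE r in lborel. ennreal (\<alpha> * r powr (- \<alpha> - 1)) * indicator {s<..} r * indicator {0<..} r =
        ennreal (\<alpha> * r powr (- \<alpha> - 1)) * indicator {s..} r"
      using AE_lborel_singleton[of s] by eventually_elim (use assms in \<open>auto simp: indicator_def\<close>)
  qed
  also have "\<dots> = ennreal (0 - (- (s powr - \<alpha>)))"
  proof (rule nn_integral_FTC_atLeast)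
    show "DERIV (\<lambda>r. - (r powr - \<alpha>)) r :> \<alpha> * r powr (- \<alpha> - 1)" if "s \<le> r" for r
      using that assms by (auto intro!: derivative_eq_intros)
    show "((\<lambda>r. - (r powr - \<alpha>)) \<longlongrightarrow> 0) at_top"
      using assms(1) by real_asymp
  qed (use assms in auto)
  finally show ?thesis by simp
qed

text \<open>For \<open>n = m s\<close> the number \<open>s powr (- \<alpha> / 2)\<close> lies
  between \<open>n\<close> and \<open>n + 1\<close>, so monotonicity traps \<open>N s\<close>
  between its values at two neighbouring grid points, and the ratio of consecutive squares tends to
  1.\<close>

lemma tendsto_at_right_of_squares:
  fixes N :: "real \<Rightarrow> nat"
  assumes \<alpha>: "\<alpha> > 0" and mono: "\<And>s t. 0 < s \<Longrightarrow> s \<le> t \<Longrightarrow> N t \<le> N s"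
    and lim: "(\<lambda>n. real (N (real n powr (- 2 / \<alpha>))) / (real n)\<^sup>2) \<longlonglongrightarrow> c"
  shows "((\<lambda>s. s powr \<alpha> * real (N s)) \<longlongrightarrow> c) (at_right 0)"
proof -
  define f where "f n = real (N (real n powr (- 2 / \<alpha>))) / (real n)\<^sup>2" for n
  have f: "f \<longlonglongrightarrow> c" using lim by (simp add: f_def[abs_def])
  define m where "m s = nat \<lfloor>s powr (- \<alpha> / 2)\<rfloor>" for s
  have m: "filterlim m sequentially (at_right 0)"
  proof -
    have "filterlim (\<lambda>s. s powr (- \<alpha> / 2)) at_top (at_right 0)" using \<alpha> by real_asymp
    then have "filterlim (\<lambda>s. \<lfloor>s powr (- \<alpha> / 2)\<rfloor>) at_top (at_right 0)"
      by (rule filterlim_compose[OF filterlim_floor_sequentially])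
    then show ?thesis
      unfolding m_def by (rule filterlim_compose[OF filterlim_nat_sequentially])
  qed
  have "(\<lambda>n. f n * (real n / real (Suc n))\<^sup>2) \<longlonglongrightarrow> c * 1"
    by (intro tendsto_mult f) real_asymp
  from filterlim_compose[OF this m]
  have low: "((\<lambda>s. f (m s) * (real (m s) / real (Suc (m s)))\<^sup>2) \<longlongrightarrow> c) (at_right 0)" by simp
  have "(\<lambda>n. f (Suc n) * (real (Suc n) / real n)\<^sup>2) \<longlonglongrightarrow> c * 1"
    by (intro tendsto_mult filterlim_compose[OF f filterlim_Suc]) real_asymp
  from filterlim_compose[OF this m]
  have up: "((\<lambda>s. f (Suc (m s)) * (real (Suc (m s)) / real (m s))\<^sup>2) \<longlongrightarrow> c) (at_right 0)" by simp
  have *: "\<forall>\<^sub>F s in at_right 0. f (m s) * (real (m s) / real (Suc (m s)))\<^sup>2 \<le> s powr \<alpha> * real (N s) \<and>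
      s powr \<alpha> * real (N s) \<le> f (Suc (m s)) * (real (Suc (m s)) / real (m s))\<^sup>2"
    using eventually_at_right_less[of 0] eventually_compose_filterlim[OF eventually_gt_at_top[of 0] m]
  proof eventually_elim
    case (elim s)
    define n where "n = m s"
    define y where "y = s powr (- \<alpha> / 2)"
    have y: "y > 0" "y powr (- 2 / \<alpha>) = s" "s powr \<alpha> = 1 / y\<^sup>2"
    proof -
      show "y > 0" using elim by (simp add: y_def)
      show "y powr (- 2 / \<alpha>) = s" using elim \<alpha> by (simp add: y_def powr_powr)
      have "y\<^sup>2 = s powr (- \<alpha>)" using elim by (simp add: y_def power2_eq_square flip: powr_add)
      then show "s powr \<alpha> = 1 / y\<^sup>2" using elim by (simp add: powr_minus divide_inverse)
    qed
    have n: "real n \<le> y" "y < real (Suc n)" "n > 0"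
      using y elim(2) by (auto simp: n_def m_def y_def) linarith+
    have "s \<le> real n powr (- 2 / \<alpha>)"
      using powr_mono2'[of "- 2 / \<alpha>" "real n" y] n \<alpha> y by simp
    then have N1: "N (real n powr (- 2 / \<alpha>)) \<le> N s" using mono elim by blast
    have "real (Suc n) powr (- 2 / \<alpha>) \<le> s"
      using powr_mono2'[of "- 2 / \<alpha>" y "real (Suc n)"] n \<alpha> y by simp
    then have N2: "N s \<le> N (real (Suc n) powr (- 2 / \<alpha>))" by (intro mono) auto
    have sq: "(real n)\<^sup>2 \<le> y\<^sup>2" "y\<^sup>2 \<le> (real (Suc n))\<^sup>2"
      using n y(1) by (intro power_mono; simp)+
    have "f n * (real n / real (Suc n))\<^sup>2 = real (N (real n powr (- 2 / \<alpha>))) / (real (Suc n))\<^sup>2"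
      using n by (simp add: f_def power_divide)
    also have "\<dots> \<le> real (N s) / y\<^sup>2" using N1 sq y(1) by (intro frac_le) auto
    finally have 1: "f n * (real n / real (Suc n))\<^sup>2 \<le> s powr \<alpha> * real (N s)" by (simp add: y)
    have "real (N s) / y\<^sup>2 \<le> real (N (real (Suc n) powr (- 2 / \<alpha>))) / (real n)\<^sup>2"
      using N2 sq n by (intro frac_le) auto
    also have "\<dots> = f (Suc n) * (real (Suc n) / real n)\<^sup>2"
      by (simp add: f_def power_divide)
    finally show ?case using 1 by (simp add: y n_def)
  qed
  show ?thesis
    by (rule tendsto_sandwich[OF _ _ low up]) (use * in \<open>auto elim: eventually_mono\<close>)
qed

lemma card_eq_if_point_count_eq:
  assumes "point_count \<xi> B \<omega> = of_nat n"
  shows "finite (\<xi> \<omega> \<inter> B)" "card (\<xi> \<omega> \<inter> B) = n"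
proof -
  show fin: "finite (\<xi> \<omega> \<inter> B)"
    using assms by (intro ccontr[of "finite _"]) (simp add: point_count_def)
  then show "card (\<xi> \<omega> \<inter> B) = n"
    using assms by (simp add: point_count_def)
qed

text \<open>At the grid point \<open>s n\<close> the mean is \<open>c\<close> times the square of
  \<open>n\<close>. A deviation by the fraction \<open>1 / Suc k\<close> of that square has
  probability of order \<open>1 / n\<^sup>2\<close>, which is summable; countably many
  \<open>k\<close> give the limit.\<close>

lemma poisson_point_process_count_asymptotics:
  fixes B :: "real \<Rightarrow> 'a set" and \<alpha> c :: real
  assumes ppp: "poisson_point_process M \<mu> \<xi>" and \<alpha>: "\<alpha> > 0" and c: "c > 0"
    and sets: "\<And>s. s > 0 \<Longrightarrow> B s \<in> sets \<mu>"
    and em: "\<And>s. s > 0 \<Longrightarrow> emeasure \<mu> (B s) = ennreal (c * s powr - \<alpha>)"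
    and mono: "\<And>s t. 0 < s \<Longrightarrow> s \<le> t \<Longrightarrow> B t \<subseteq> B s"
  shows "AE \<omega> in M. (\<forall>s>0. finite (\<xi> \<omega> \<inter> B s)) \<and>
    ((\<lambda>s. s powr \<alpha> * real (card (\<xi> \<omega> \<inter> B s))) \<longlongrightarrow> c) (at_right 0)"
proof -
  interpret prob_space M using ppp by (simp add: poisson_point_process_def)
  define s where "s n = real n powr (- 2 / \<alpha>)" for n :: nat
  define X where "X n = point_count \<xi> (B (s n))" for n
  \<comment> \<open>An infinite count is bad as well, so good outcomes also yield
    finiteness.\<close>
  define bad where "bad k n = {\<omega> \<in> space M. \<not> (\<exists>j. X n \<omega> = of_nat j \<and>
    \<bar>real j - c * (real n)\<^sup>2\<bar> < (real n)\<^sup>2 / real (Suc k))}" for k n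
  have bad: "bad k n \<in> events \<and> prob (bad k n) \<le> (c * (real (Suc k))\<^sup>2) * inverse ((real n)\<^sup>2)"
    if "n > 0" for k n
  proof -
    have s: "s n > 0" using that by (simp add: s_def)
    have "s n powr - \<alpha> = (real n)\<^sup>2" using \<alpha> that by (simp add: s_def powr_powr powr_numeral)
    then have em': "emeasure \<mu> (B (s n)) = ennreal (c * (real n)\<^sup>2)" using em[OF s] by simp
    then have "measure \<mu> (B (s n)) = c * (real n)\<^sup>2" using c by (simp add: measure_def)
    then have dist: "prob {\<omega> \<in> space M. X n \<omega> = of_nat j} =
        (c * (real n)\<^sup>2) ^ j / fact j * exp (- (c * (real n)\<^sup>2))" for j
      using ppp sets[OF s] em' by (simp add: poisson_point_process_def X_def)
    have X: "X n \<in> borel_measurable M"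
      using ppp sets[OF s] by (simp add: poisson_point_process_def X_def)
    have pos: "(real n)\<^sup>2 / real (Suc k) > 0" using that by simp
    have "prob (bad k n) \<le> (c * (real n)\<^sup>2) / ((real n)\<^sup>2 / real (Suc k))\<^sup>2"
      unfolding bad_def by (rule poisson_chebyshev(2)[OF X pos dist])
    also have "\<dots> = (c * (real (Suc k))\<^sup>2) * inverse ((real n)\<^sup>2)"
      using that by (simp add: field_simps power2_eq_square del: of_nat_Suc)
    finally show ?thesis
      using poisson_chebyshev(1)[OF X pos dist] by (simp add: bad_def)
  qed
  \<comment> \<open>The shift to \<open>Suc n\<close> avoids \<open>s 0 = 0\<close>, where the
    assumptions on \<open>B\<close> say nothing.\<close>
  have "AE \<omega> in M. \<forall>\<^sub>F n in sequentially. \<omega> \<in> space M - bad k (Suc n)" for k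
  proof (rule borel_cantelli_AE1)
    have "summable (\<lambda>n. (c * (real (Suc k))\<^sup>2) * inverse ((real (Suc n))\<^sup>2))"
      using inverse_power_summable[of 2, where 'a = real]
      by (intro summable_mult) (simp add: summable_Suc_iff[of "\<lambda>n. inverse ((real n)\<^sup>2)"] del: of_nat_Suc)
    then show "summable (\<lambda>n. prob (bad k (Suc n)))"
      by (rule summable_comparison_test') (use bad[of "Suc n" k for n] in \<open>simp del: of_nat_Suc\<close>)
  qed (use bad[of "Suc n" k for n] in \<open>auto simp: emeasure_eq_measure\<close>)
  then have "AE \<omega> in M. \<forall>k. \<forall>\<^sub>F n in sequentially. \<omega> \<in> space M - bad k (Suc n)"
    unfolding AE_all_countable by blast
  then show ?thesis
  proof eventually_elim
    case (elim \<omega>)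
    define N where "N t = card (\<xi> \<omega> \<inter> B t)" for t
    have ev: "\<forall>\<^sub>F n in sequentially. finite (\<xi> \<omega> \<inter> B (s n)) \<and>
        \<bar>real (N (s n)) / (real n)\<^sup>2 - c\<bar> < 1 / real (Suc k)" for k
    proof -
      have "\<forall>\<^sub>F n in sequentially. \<omega> \<in> space M - bad k n"
        using elim[rule_format, of k] unfolding eventually_sequentially_Suc[of "\<lambda>n. \<omega> \<in> space M - bad k n"] .
      then show ?thesis
        using eventually_gt_at_top[of 0]
      proof eventually_elim
        case (elim n)
        then obtain j where j: "X n \<omega> = of_nat j" "\<bar>real j - c * (real n)\<^sup>2\<bar> < (real n)\<^sup>2 / real (Suc k)"
          by (auto simp: bad_def)
        have *: "finite (\<xi> \<omega> \<inter> B (s n))" "N (s n) = j"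
          using card_eq_if_point_count_eq[of \<xi> "B (s n)" \<omega> j] j(1) by (auto simp: X_def N_def)
        have sq: "(real n)\<^sup>2 > 0" using elim by simp
        have "real j / (real n)\<^sup>2 - c = (real j - c * (real n)\<^sup>2) / (real n)\<^sup>2"
          using sq by (simp add: diff_divide_distrib)
        then have "\<bar>real j / (real n)\<^sup>2 - c\<bar> = \<bar>real j - c * (real n)\<^sup>2\<bar> / (real n)\<^sup>2"
          using sq by (simp add: abs_divide)
        also have "\<dots> < ((real n)\<^sup>2 / real (Suc k)) / (real n)\<^sup>2"
          using j(2) sq by (rule divide_strict_right_mono)
        also have "\<dots> = 1 / real (Suc k)" using sq by simp
        finally show ?case using * by simp
      qed
    qed
    have fin: "finite (\<xi> \<omega> \<inter> B t)" if "t > 0" for t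
    proof -
      have "s \<longlonglongrightarrow> 0" unfolding s_def using \<alpha> by real_asymp
      then have "\<forall>\<^sub>F n in sequentially. s n < t" using that by (rule order_tendstoD)
      then have "\<forall>\<^sub>F n in sequentially. s n < t \<and> finite (\<xi> \<omega> \<inter> B (s n)) \<and> n > 0"
        using ev[of 0] eventually_gt_at_top[of 0] by eventually_elim auto
      then obtain n where n: "s n < t" "finite (\<xi> \<omega> \<inter> B (s n))" "n > 0"
        using eventually_happens[of _ sequentially] by auto
      then have "B t \<subseteq> B (s n)" by (intro mono) (auto simp: s_def)
      then show ?thesis using n(2) by (meson Int_mono finite_subset order_refl)
    qed
    have "(\<lambda>n. real (N (s n)) / (real n)\<^sup>2) \<longlonglongrightarrow> c"
    proof (rule tendstoI)
      fix \<epsilon> :: real assume "\<epsilon> > 0"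
      then obtain k where "1 / real (Suc k) < \<epsilon>" using nat_approx_posE by blast
      then show "\<forall>\<^sub>F n in sequentially. dist (real (N (s n)) / (real n)\<^sup>2) c < \<epsilon>"
        using ev[of k] by (auto simp: dist_real_def elim: eventually_mono)
    qed
    then have "((\<lambda>t. t powr \<alpha> * real (N t)) \<longlongrightarrow> c) (at_right 0)"
      unfolding s_def
      by (rule tendsto_at_right_of_squares[OF \<alpha>, rotated])
        (auto simp: N_def intro!: card_mono fin dest: mono)
    then show ?case using fin by (simp add: N_def)
  qed
qed

section \<open>The Poisson process on finitely many rays\<close>

lemma sets_polar_measure_cone:
  fixes \<nu> :: "'a::euclidean_space measure"
  assumes "B \<in> sets borel" "E \<in> sets borel"
  shows "{x. x \<noteq> 0 \<and> norm x \<in> B \<and> x /\<^sub>R norm x \<in> E} \<in> sets (polar_measure \<theta> \<nu>)" (is "?X \<in> _")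
proof -
  have "?X = - {0} \<inter> (norm -` B \<inter> space borel) \<inter> ((\<lambda>x. x /\<^sub>R norm x) -` E \<inter> space borel)"
    by auto
  also have "\<dots> \<in> sets borel"
    using assms by (intro sets.Int measurable_sets[of _ borel borel]) auto
  finally show ?thesis
    by (auto simp: polar_measure_def sets_restrict_space)
qed

text \<open>Puts a ray into polar form, the shape of set on which \<open>polar_measure\<close>
  factorises.\<close>

lemma open_ray_eq:
  fixes v :: "'a::real_normed_vector"
  assumes "norm v = 1" "s > 0"
  shows "{x. x \<noteq> 0 \<and> norm x \<in> {s<..} \<and> x /\<^sub>R norm x \<in> {v}} = (\<lambda>r. r *\<^sub>R v) ` {s<..}"
proof -
  have "x = norm x *\<^sub>R v" if "x \<noteq> 0" "x /\<^sub>R norm x = v" for x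
    using that by auto
  then show ?thesis using assms by (force simp: image_iff)
qed

lemma card_scaleR_ray:
  fixes v :: "'a::real_vector"
  assumes "v \<noteq> 0"
  shows "card {r. s < r \<and> r *\<^sub>R v \<in> S} = card (S \<inter> (\<lambda>r. r *\<^sub>R v) ` {s<..})"
    and "finite {r. s < r \<and> r *\<^sub>R v \<in> S} \<longleftrightarrow> finite (S \<inter> (\<lambda>r. r *\<^sub>R v) ` {s<..})"
proof -
  have eq: "S \<inter> (\<lambda>r. r *\<^sub>R v) ` {s<..} = (\<lambda>r. r *\<^sub>R v) ` {r. s < r \<and> r *\<^sub>R v \<in> S}" by auto
  have inj: "inj_on (\<lambda>r. r *\<^sub>R v) X" for X using assms by (auto simp: inj_on_def)
  show "card {r. s < r \<and> r *\<^sub>R v \<in> S} = card (S \<inter> (\<lambda>r. r *\<^sub>R v) ` {s<..})"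
    unfolding eq by (rule card_image[OF inj, symmetric])
  show "finite {r. s < r \<and> r *\<^sub>R v \<in> S} \<longleftrightarrow> finite (S \<inter> (\<lambda>r. r *\<^sub>R v) ` {s<..})"
    unfolding eq by (rule finite_image_iff[OF inj, symmetric])
qed

text \<open>Finitely many radii would keep the count bounded, and the normalised count would tend to
  0 and not to \<open>c\<close>.\<close>

lemma infinite_if_count_asymptotics:
  fixes R :: "real set"
  assumes "\<alpha> > 0" "c > 0"
    and lim: "((\<lambda>s. s powr \<alpha> * real (card {r. s < r \<and> r \<in> R})) \<longlongrightarrow> c) (at_right 0)"
  shows "infinite {r. 0 < r \<and> r \<in> R}"
proof
  assume fin: "finite {r. 0 < r \<and> r \<in> R}"
  let ?F = "{r. 0 < r \<and> r \<in> R}"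
  have "((\<lambda>s. s powr \<alpha> * real (card {r. s < r \<and> r \<in> R})) \<longlongrightarrow> 0) (at_right 0)"
  proof (rule tendsto_sandwich[where f = "\<lambda>_. 0"])
    show "((\<lambda>s. s powr \<alpha> * real (card ?F)) \<longlongrightarrow> 0) (at_right 0)"
    proof -
      have "((\<lambda>s. s powr \<alpha>) \<longlongrightarrow> 0) (at_right 0)" using assms(1) by real_asymp
      from tendsto_mult_left_zero[OF this] show ?thesis .
    qed
    show "\<forall>\<^sub>F s in at_right 0. s powr \<alpha> * real (card {r. s < r \<and> r \<in> R}) \<le> s powr \<alpha> * real (card ?F)"
      using eventually_at_right_less[of 0]
      by eventually_elim (auto intro!: mult_left_mono card_mono fin)
  qed auto
  then have "c = 0" using tendsto_unique[OF _ lim] by simp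
  then show False using assms by simp
qed

theorem theorem2:
  fixes \<alpha> :: real
    and \<nu> :: "'a::euclidean_space measure"
    and e :: "nat \<Rightarrow> 'a"
    and l :: nat
    and M :: "'w measure"
    and \<xi> :: "'w \<Rightarrow> 'a set"
  assumes "\<alpha> > 0"
    and "sets \<nu> = sets (restrict_space borel (sphere 0 1))"
    and "emeasure \<nu> (sphere 0 1) = 1"
    and "e ` {1..l} \<subseteq> sphere 0 1"
    and "inj_on e {1..l}"
    and "emeasure \<nu> (sphere 0 1 - e ` {1..l}) = 0"
    and "\<And>i. i \<in> {1..l} \<Longrightarrow> measure \<nu> {e i} > 0"
    and "convex_cone hull (e ` {1..l}) = UNIV"
    and "poisson_point_process M (polar_measure (pareto_intensity \<alpha>) \<nu>) \<xi>"
  shows "AE \<omega> in M.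
    (\<lambda>k. hausdorff_distance
           ((\<lambda>x. real k powr (1 / \<alpha>) *\<^sub>R x) ` peeling_hull (\<xi> \<omega>) k)
           (convex hull ((\<lambda>i. measure \<nu> {e i} powr (1 / \<alpha>) *\<^sub>R e i) ` {1..l}))) \<longlonglongrightarrow> 0"
proof -
  define \<theta> where "\<theta> = pareto_intensity \<alpha>"
  define \<mu> where "\<mu> = polar_measure \<theta> \<nu>"
  have ppp: "poisson_point_process M \<mu> \<xi>" using assms(9) by (simp add: \<mu>_def \<theta>_def)
  interpret prob_space M using ppp by (simp add: poisson_point_process_def)
  have "space \<nu> = sphere 0 1"
    using sets_eq_imp_space_eq[OF assms(2)] by (simp add: space_restrict_space)
  then interpret \<nu>: finite_measure \<nu> using assms(3) by (intro finite_measureI) simp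
  have sets_\<theta>: "sets \<theta> = sets (restrict_space borel {0<..})"
    by (simp add: \<theta>_def pareto_intensity_def sets_restrict_space)
  note em = emeasure_polar_measure[OF sets_\<theta> assms(2) \<nu>.finite_measure_axioms, folded \<mu>_def]
  have norm: "norm (e i) = 1" if "i \<in> {1..l}" for i
  proof -
    have "e i \<in> sphere 0 1" using assms(4) that by blast
    then show ?thesis by simp
  qed
  \<comment> \<open>The directions outside the atoms form a \<open>\<nu>\<close>-null set, so this
    region has intensity 0 and almost surely contains no points.\<close>
  define Off where "Off = {x::'a. x \<noteq> 0 \<and> norm x \<in> {0<..} \<and> x /\<^sub>R norm x \<in> sphere 0 1 - e ` {1..l}}"
  have off_borel: "sphere 0 1 - e ` {1..l} \<in> sets borel"
    using finite_imp_closed[of "e ` {1..l}"] by (intro sets.Diff borel_closed closed_sphere) auto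
  have Off: "Off \<in> sets \<mu>"
    unfolding Off_def \<mu>_def by (intro sets_polar_measure_cone off_borel) auto
  have "emeasure \<mu> Off = 0"
    unfolding Off_def using em[of "{0<..}" "sphere 0 1 - e ` {1..l}"] off_borel assms(6) by simp
  then have "emeasure \<mu> Off < \<infinity>" "measure \<mu> Off = 0" by (simp_all add: measure_def)
  then have "prob {\<omega> \<in> space M. point_count \<xi> Off \<omega> = of_nat n} = 0 ^ n / fact n * exp (- 0)" for n
    using ppp Off unfolding poisson_point_process_def by metis
  \<comment> \<open>The Poisson law with mean 0 has full mass at 0, because
    \<open>0 ^ 0 = 1\<close>.\<close>
  from this[of 0] have "prob {\<omega> \<in> space M. point_count \<xi> Off \<omega> = of_nat 0} = 1" by simp
  then have "AE \<omega> in M. point_count \<xi> Off \<omega> = of_nat 0"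
    using AE_prob_1 by fastforce
  moreover have "AE \<omega> in M. \<forall>i\<in>{1..l}. (\<forall>s>0. finite (\<xi> \<omega> \<inter> (\<lambda>r. r *\<^sub>R e i) ` {s<..})) \<and>
      ((\<lambda>s. s powr \<alpha> * real (card (\<xi> \<omega> \<inter> (\<lambda>r. r *\<^sub>R e i) ` {s<..}))) \<longlongrightarrow> measure \<nu> {e i}) (at_right 0)"
  proof (intro AE_finite_allI poisson_point_process_count_asymptotics[OF ppp assms(1)])
    fix i s assume i: "i \<in> {1..l}"
    show "measure \<nu> {e i} > 0" using assms(7)[OF i] .
    assume s: "(s::real) > 0"
    show "(\<lambda>r. r *\<^sub>R e i) ` {s<..} \<in> sets \<mu>"
      unfolding open_ray_eq[OF norm[OF i] s, symmetric] \<mu>_def by (intro sets_polar_measure_cone) auto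
    have "emeasure \<mu> ((\<lambda>r. r *\<^sub>R e i) ` {s<..}) = emeasure \<theta> {s<..} * emeasure \<nu> {e i}"
      unfolding open_ray_eq[OF norm[OF i] s, symmetric] using s norm[OF i] by (intro em) auto
    also have "\<dots> = ennreal (s powr - \<alpha>) * ennreal (measure \<nu> {e i})"
      using assms(1) s by (simp add: \<theta>_def emeasure_pareto_intensity_greaterThan \<nu>.emeasure_eq_measure)
    also have "\<dots> = ennreal (measure \<nu> {e i} * s powr - \<alpha>)"
      by (simp add: ennreal_mult mult.commute)
    finally show "emeasure \<mu> ((\<lambda>r. r *\<^sub>R e i) ` {s<..}) = ennreal (measure \<nu> {e i} * s powr - \<alpha>)" .
  qed auto
  ultimately show ?thesis
    using AE_space
  proof eventually_elim
    case (elim \<omega>)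
    have ne0: "e i \<noteq> 0" if "i \<in> {1..l}" for i using norm[OF that] by auto
    have lim: "((\<lambda>s. s powr \<alpha> * real (card {r. s < r \<and> r *\<^sub>R e i \<in> \<xi> \<omega>})) \<longlongrightarrow> measure \<nu> {e i}) (at_right 0)"
      if "i \<in> {1..l}" for i
      using elim(2) that by (simp only: card_scaleR_ray(1)[OF ne0[OF that]])
    interpret ray_configuration "{1..l}" e "\<xi> \<omega>"
    proof
      fix x assume x: "x \<in> \<xi> \<omega>"
      have "space \<mu> = - {0}"
        by (simp add: \<mu>_def polar_measure_def space_restrict_space)
      then have "x \<noteq> 0" using ppp elim(3) x by (auto simp: poisson_point_process_def)
      have "\<xi> \<omega> \<inter> Off = {}"
        using card_eq_if_point_count_eq[OF elim(1)] by simp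
      then have "x /\<^sub>R norm x \<in> e ` {1..l}" using x \<open>x \<noteq> 0\<close> by (auto simp: Off_def)
      then obtain i where i: "i \<in> {1..l}" "x /\<^sub>R norm x = e i" by blast
      then have "x = norm x *\<^sub>R e i" using \<open>x \<noteq> 0\<close> by (simp flip: i(2))
      then show "\<exists>i\<in>{1..l}. \<exists>r>0. x = r *\<^sub>R e i" using i(1) \<open>x \<noteq> 0\<close> by (metis zero_less_norm_iff)
    next
      fix i s assume i: "i \<in> {1..l}" and "(s::real) > 0"
      then show "finite {r. s < r \<and> r *\<^sub>R e i \<in> \<xi> \<omega>}"
        using elim(2) by (simp only: card_scaleR_ray(2)[OF ne0[OF i]])
    next
      fix i assume i: "i \<in> {1..l}"
      show "infinite {r. 0 < r \<and> r *\<^sub>R e i \<in> \<xi> \<omega>}"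
        using infinite_if_count_asymptotics[of \<alpha> _ "{r. r *\<^sub>R e i \<in> \<xi> \<omega>}"] assms(1) assms(7)[OF i] lim[OF i]
        by simp
    qed (use norm assms(5) in auto)
    \<comment> \<open>Without directions the generated cone is only the origin, whereas a Euclidean
      space has positive dimension.\<close>
    have "{1..l} \<noteq> {}"
    proof
      assume "{1..l} = {}"
      then have "(UNIV :: 'a set) = {0}" using assms(8) by simp
      then show False by (metis UNIV_I nonempty_Basis nonzero_Basis all_not_in_conv singletonD)
    qed
    then show ?case
      using lim assms by (intro peeling_hull_tendsto) (auto simp: count_above_def)
  qed
qed

end
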